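(* Let $T$ be a complete NIP theory with monster model $\mathcal U$. Suppose $A\subseteq B\subseteq C$ are small subsets of $\mathcal U$, $C$ is compressible over $B$, and $B$ is compressible over $A$. Then $C$ is compressible over $A$.
   Context: $T$ is a complete theory in a language $\mathcal L$, $\mathcal U$ a large saturated model; small means of cardinality $<|\mathcal U|$; $\vdash$ is implication in $\mathcal U$. $T$ is NIP if for every $\mathcal L$-formula $\phi(x,y)$ the family $\{\phi(\mathcal U^x,b):b\in\mathcal U^y\}$ has finite VC-dimension. A type $p(x)\in S(A)$ (in a possibly infinite tuple of variables $x$) is compressible if for every $\mathcal L$-formula $\phi(x,y)$ there is an $\mathcal L$-formula $\psi(x,z)$ such that for every finite $A_0\subseteq A$ there is $c\in A^z$ with $\psi(x,c)\in p$ and $\psi(x,c)\vdash\{\phi(x,a)\in p:a\in A_0^y\}\cup\{\neg\phi(x,a)\in p:a\in A_0^y\}$. A set $B$ is compressible over a set $A$ if $\mathrm{tp}(\bar b/A)$ is compressible for some (equivalently any) tuple $\bar b$ enumerating $B$; equivalently, $\mathrm{tp}(b/A)$ is compressible for every finite tuple $b$ from $B$. *)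

theory Defs
  imports Main "HOL-Library.FuncSet" "HOL-Library.Equipollence"
begin

section \<open>First-order syntax\<close>

text \<open>
  Symbols are paired with their arities; the types \<open>'f\<close> and \<open>'r\<close> only supply names, so a
  language may have no function symbols or no relation symbols.
\<close>

record ('f, 'r) fo_language =
  Funs :: "('f \<times> nat) set"
  Rels :: "('r \<times> nat) set"

text \<open>
  Bound variables are de Bruijn indices, free variables come from an arbitrary type \<open>'v\<close>. Hence
  formulas in infinite tuples of variables are available, and renaming free variables with
  \<open>map_fm\<close> cannot capture anything.
\<close>

datatype (dead 'f, tm_vars: 'v) tm =
    Var 'v
  | Bound nat
  | App 'f "('f, 'v) tm list"

datatype (dead 'f, dead 'r, fm_vars: 'v) fm =
    Eq "('f, 'v) tm" "('f, 'v) tm"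
  | Rel 'r "('f, 'v) tm list"
  | Neg "('f, 'r, 'v) fm"
  | Conj "('f, 'r, 'v) fm" "('f, 'r, 'v) fm"
  | Ex "('f, 'r, 'v) fm"

text \<open>The number \<open>k\<close> counts the enclosing quantifiers.\<close>

fun wf_tm :: "('f, 'r) fo_language \<Rightarrow> nat \<Rightarrow> ('f, 'v) tm \<Rightarrow> bool" where
  "wf_tm L k (Var x) \<longleftrightarrow> True"
| "wf_tm L k (Bound j) \<longleftrightarrow> j < k"
| "wf_tm L k (App f ts) \<longleftrightarrow> (f, length ts) \<in> Funs L \<and> (\<forall>t \<in> set ts. wf_tm L k t)"

fun wf_fm :: "('f, 'r) fo_language \<Rightarrow> nat \<Rightarrow> ('f, 'r, 'v) fm \<Rightarrow> bool" where
  "wf_fm L k (Eq s t) \<longleftrightarrow> wf_tm L k s \<and> wf_tm L k t"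
| "wf_fm L k (Rel r ts) \<longleftrightarrow> (r, length ts) \<in> Rels L \<and> (\<forall>t \<in> set ts. wf_tm L k t)"
| "wf_fm L k (Neg \<phi>) \<longleftrightarrow> wf_fm L k \<phi>"
| "wf_fm L k (Conj \<phi> \<psi>) \<longleftrightarrow> wf_fm L k \<phi> \<and> wf_fm L k \<psi>"
| "wf_fm L k (Ex \<phi>) \<longleftrightarrow> wf_fm L (Suc k) \<phi>"

definition formulas :: "('f, 'r) fo_language \<Rightarrow> 'v set \<Rightarrow> ('f, 'r, 'v) fm set" where
  "formulas L V = {\<phi>. wf_fm L 0 \<phi> \<and> fm_vars \<phi> \<subseteq> V}"

definition sentences :: "('f, 'r) fo_language \<Rightarrow> ('f, 'r, nat) fm set" where
  "sentences L = formulas L {}"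


section \<open>Structures and theories\<close>

record ('f, 'r, 'a) fo_structure =
  univ :: "'a set"
  fun_int :: "'f \<Rightarrow> 'a list \<Rightarrow> 'a"
  rel_int :: "'r \<Rightarrow> 'a list \<Rightarrow> bool"

definition is_structure :: "('f, 'r) fo_language \<Rightarrow> ('f, 'r, 'a) fo_structure \<Rightarrow> bool" where
  "is_structure L M \<longleftrightarrow> univ M \<noteq> {} \<and>
     (\<forall>(f, n) \<in> Funs L. \<forall>as \<in> lists (univ M). length as = n \<longrightarrow> fun_int M f as \<in> univ M)"

primrec eval_tm :: "('f, 'r, 'a) fo_structure \<Rightarrow> ('v \<Rightarrow> 'a) \<Rightarrow> (nat \<Rightarrow> 'a) \<Rightarrow> ('f, 'v) tm \<Rightarrow> 'a" where
  "eval_tm M v e (Var x) = v x"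
| "eval_tm M v e (Bound j) = e j"
| "eval_tm M v e (App f ts) = fun_int M f (map (eval_tm M v e) ts)"

primrec sat_fm :: "('f, 'r, 'a) fo_structure \<Rightarrow> ('v \<Rightarrow> 'a) \<Rightarrow> (nat \<Rightarrow> 'a) \<Rightarrow> ('f, 'r, 'v) fm \<Rightarrow> bool" where
  "sat_fm M v e (Eq s t) \<longleftrightarrow> eval_tm M v e s = eval_tm M v e t"
| "sat_fm M v e (Rel r ts) \<longleftrightarrow> rel_int M r (map (eval_tm M v e) ts)"
| "sat_fm M v e (Neg \<phi>) \<longleftrightarrow> \<not> sat_fm M v e \<phi>"
| "sat_fm M v e (Conj \<phi> \<psi>) \<longleftrightarrow> sat_fm M v e \<phi> \<and> sat_fm M v e \<psi>"
| "sat_fm M v e (Ex \<phi>) \<longleftrightarrow> (\<exists>a \<in> univ M. sat_fm M v (case_nat a e) \<phi>)"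

text \<open>
  Members of \<open>formulas L V\<close> have no dangling de Bruijn index, so for them the environment
  \<open>\<lambda>_. undefined\<close> is irrelevant.
\<close>

definition sat :: "('f, 'r, 'a) fo_structure \<Rightarrow> ('v \<Rightarrow> 'a) \<Rightarrow> ('f, 'r, 'v) fm \<Rightarrow> bool" where
  "sat M v \<phi> \<longleftrightarrow> sat_fm M v (\<lambda>_. undefined) \<phi>"

definition models ::
  "('f, 'r) fo_language \<Rightarrow> ('f, 'r, nat) fm set \<Rightarrow> ('f, 'r, 'a) fo_structure \<Rightarrow> bool" where
  "models L T M \<longleftrightarrow> is_structure L M \<and> (\<forall>\<sigma> \<in> T. sat M (\<lambda>_. undefined) \<sigma>)"

text \<open>
  HOL cannot quantify over structures of all types. By the downward Loewenheim-Skolem theorem a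
  satisfiable set of \<open>L\<close>-sentences has a model of cardinality at most \<open>|L| + \<aleph>\<^sub>0\<close>, hence one whose
  universe is a set of elements of type \<open>('f, 'r, nat) fm\<close>. So testing satisfiability and
  consequence on such structures gives the usual notions.
\<close>

definition satisfiable :: "('f, 'r) fo_language \<Rightarrow> ('f, 'r, nat) fm set \<Rightarrow> bool" where
  "satisfiable L T \<longleftrightarrow>
     (\<exists>N :: ('f, 'r, ('f, 'r, nat) fm) fo_structure. models L T N)"

definition consequence ::
  "('f, 'r) fo_language \<Rightarrow> ('f, 'r, nat) fm set \<Rightarrow> ('f, 'r, nat) fm \<Rightarrow> bool" where
  "consequence L T \<sigma> \<longleftrightarrow>
     (\<forall>N :: ('f, 'r, ('f, 'r, nat) fm) fo_structure. models L T N \<longrightarrow> models L {\<sigma>} N)"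

definition complete_theory :: "('f, 'r) fo_language \<Rightarrow> ('f, 'r, nat) fm set \<Rightarrow> bool" where
  "complete_theory L T \<longleftrightarrow> T \<subseteq> sentences L \<and> satisfiable L T \<and>
     (\<forall>\<sigma> \<in> sentences L. consequence L T \<sigma> \<or> consequence L T (Neg \<sigma>))"


section \<open>Types over parameter sets\<close>

text \<open>
  An \<open>L(A)\<close>-formula in the tuple \<open>x = (x\<^sub>i)\<^sub>i\<^sub>\<in>\<^sub>I\<close> is an element of \<open>formulas L (I <+> A)\<close>: the free
  variable \<open>Inl i\<close> is \<open>x\<^sub>i\<close>, and \<open>Inr a\<close> is the parameter \<open>a\<close>, always evaluated to itself. An
  \<open>L\<close>-formula \<open>\<phi>(x,y)\<close> with \<open>y\<close> of length \<open>n\<close> is an element of \<open>formulas L (I <+> {..<n})\<close>,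
  \<open>inst \<phi> a\<close> is \<open>\<phi>(x,a)\<close>, and \<open>A\<^sup>y\<close> is \<open>{..<n} \<rightarrow>\<^sub>E A\<close>.
\<close>

definition inst :: "('f, 'r, 'i + nat) fm \<Rightarrow> (nat \<Rightarrow> 'a) \<Rightarrow> ('f, 'r, 'i + 'a) fm" where
  "inst \<phi> a = map_fm (map_sum id a) \<phi>"

definition holds_at :: "('f, 'r, 'a) fo_structure \<Rightarrow> ('i \<Rightarrow> 'a) \<Rightarrow> ('f, 'r, 'i + 'a) fm \<Rightarrow> bool" where
  "holds_at M d \<chi> \<longleftrightarrow> sat M (case_sum d id) \<chi>"

definition implies ::
  "('f, 'r, 'a) fo_structure \<Rightarrow> 'i set \<Rightarrow> ('f, 'r, 'i + 'a) fm \<Rightarrow> ('f, 'r, 'i + 'a) fm set \<Rightarrow> bool" where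
  "implies M I \<psi> \<Sigma> \<longleftrightarrow>
     (\<forall>d \<in> I \<rightarrow>\<^sub>E univ M. holds_at M d \<psi> \<longrightarrow> (\<forall>\<sigma> \<in> \<Sigma>. holds_at M d \<sigma>))"

definition complete_types ::
  "('f, 'r) fo_language \<Rightarrow> ('f, 'r, 'a) fo_structure \<Rightarrow> 'i set \<Rightarrow> 'a set \<Rightarrow> ('f, 'r, 'i + 'a) fm set set" where
  "complete_types L M I A =
     {p. p \<subseteq> formulas L (I <+> A) \<and>
         (\<forall>q. finite q \<and> q \<subseteq> p \<longrightarrow> (\<exists>d \<in> I \<rightarrow>\<^sub>E univ M. \<forall>\<chi> \<in> q. holds_at M d \<chi>)) \<and>
         (\<forall>\<chi> \<in> formulas L (I <+> A). \<chi> \<in> p \<or> Neg \<chi> \<in> p)}"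

definition tp ::
  "('f, 'r) fo_language \<Rightarrow> ('f, 'r, 'a) fo_structure \<Rightarrow> 'i set \<Rightarrow> ('i \<Rightarrow> 'a) \<Rightarrow> 'a set \<Rightarrow> ('f, 'r, 'i + 'a) fm set" where
  "tp L M I b A = {\<chi> \<in> formulas L (I <+> A). holds_at M b \<chi>}"


section \<open>Monster models and NIP\<close>

definition small :: "('f, 'r, 'a) fo_structure \<Rightarrow> 'a set \<Rightarrow> bool" where
  "small M A \<longleftrightarrow> A \<subseteq> univ M \<and> A \<prec> univ M"

definition saturated :: "('f, 'r) fo_language \<Rightarrow> ('f, 'r, 'a) fo_structure \<Rightarrow> bool" where
  "saturated L M \<longleftrightarrow>
     (\<forall>A. small M A \<longrightarrow>
        (\<forall>p \<in> complete_types L M (UNIV :: unit set) A.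
           \<exists>d \<in> univ M. \<forall>\<chi> \<in> p. holds_at M (\<lambda>_. d) \<chi>))"

text \<open>
  ``Large'' means \<open>|L| + \<aleph>\<^sub>0 < |U|\<close>; the left-hand side is the number of \<open>L\<close>-formulas in countably
  many variables.
\<close>

definition monster_model ::
  "('f, 'r) fo_language \<Rightarrow> ('f, 'r, nat) fm set \<Rightarrow> ('f, 'r, 'a) fo_structure \<Rightarrow> bool" where
  "monster_model L T U \<longleftrightarrow> models L T U \<and> saturated L U \<and>
     formulas L (UNIV :: nat set) \<prec> univ U"

definition shatters :: "'x set set \<Rightarrow> 'x set \<Rightarrow> bool" where
  "shatters F S \<longleftrightarrow> (\<forall>S' \<subseteq> S. \<exists>X \<in> F. X \<inter> S = S')"

definition finite_VC_dim :: "'x set set \<Rightarrow> bool" where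
  "finite_VC_dim F \<longleftrightarrow> (\<exists>d. \<forall>S. finite S \<and> shatters F S \<longrightarrow> card S \<le> d)"

text \<open>NIP of a complete theory, expressed in its monster model \<open>U\<close>.\<close>

definition NIP :: "('f, 'r) fo_language \<Rightarrow> ('f, 'r, 'a) fo_structure \<Rightarrow> bool" where
  "NIP L U \<longleftrightarrow>
     (\<forall>m n. \<forall>\<phi> \<in> formulas L ({..<m} <+> {..<n}).
        finite_VC_dim {{d \<in> {..<m::nat} \<rightarrow>\<^sub>E univ U. holds_at U d (inst \<phi> b)} | b.
                         b \<in> {..<n} \<rightarrow>\<^sub>E univ U})"


section \<open>Compressibility\<close>

definition compressible ::
  "('f, 'r) fo_language \<Rightarrow> ('f, 'r, 'a) fo_structure \<Rightarrow> 'i set \<Rightarrow> 'a set \<Rightarrow> ('f, 'r, 'i + 'a) fm set \<Rightarrow> bool" where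
  "compressible L U I A p \<longleftrightarrow>
     (\<forall>n. \<forall>\<phi> \<in> formulas L (I <+> {..<n}).
        \<exists>m. \<exists>\<psi> \<in> formulas L (I <+> {..<m}).
          \<forall>A\<^sub>0. finite A\<^sub>0 \<and> A\<^sub>0 \<subseteq> A \<longrightarrow>
            (\<exists>c \<in> {..<m} \<rightarrow>\<^sub>E A. inst \<psi> c \<in> p \<and>
               implies U I (inst \<psi> c)
                 ({inst \<phi> a | a. a \<in> {..<n} \<rightarrow>\<^sub>E A\<^sub>0 \<and> inst \<phi> a \<in> p} \<union>
                  {Neg (inst \<phi> a) | a. a \<in> {..<n} \<rightarrow>\<^sub>E A\<^sub>0 \<and> Neg (inst \<phi> a) \<in> p})))"

text \<open>
  The index set of the enumeration is taken inside the type \<open>'a\<close> of elements of the structure,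
  which is no loss since \<open>B\<close> can be indexed by itself. It is a set rather than the whole type so
  that \<open>B\<close> may be empty.
\<close>

definition compressible_over ::
  "('f, 'r) fo_language \<Rightarrow> ('f, 'r, 'a) fo_structure \<Rightarrow> 'a set \<Rightarrow> 'a set \<Rightarrow> bool" where
  "compressible_over L U B A \<longleftrightarrow>
     (\<exists>(I :: 'a set) (b :: 'a \<Rightarrow> 'a). b ` I = B \<and> compressible L U I A (tp L U I b A))"

end

theory Submission
  imports Defs "HOL-Library.Nat_Bijection"
begin

text \<open>
  Let \<open>c\<close> be a finite tuple of \<open>C\<close>, let \<open>\<Psi>(x,z)\<close> compress its \<open>\<phi>\<close>-type over \<open>B\<close>, and suppose that
  \<open>tp(c/A)\<close> is not compressible with respect to \<open>\<phi>\<close>; by symmetry only the instances \<open>\<phi>(x,y)\<close> that are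
  false at \<open>c\<close> matter. Replacing \<open>c\<close> by a tuple that looks similar over \<open>A\<close> but satisfies some
  \<open>\<phi>(x,y)\<close>, one also finds, for each \<open>b\<close> with \<open>\<Psi>(c,b)\<close> that refutes \<open>\<phi>(x,y)\<close> for all \<open>y\<close> of a finite
  set, some \<open>z\<close> similar to \<open>b\<close> that fails to do so: \<open>\<theta>(z,y)\<close> holds, where \<open>\<theta>(z,y)\<close> is
  \<open>\<exists>x. \<Psi>(x,z) \<and> \<phi>(x,y)\<close>. As \<open>\<theta>\<close> is NIP, there is a largest \<open>k\<close> such that \<open>k\<close> such failures can always be
  produced independently, in the sense that \<open>y\<^sub>0,\<dots>,y\<^sub>k\<^sub>-\<^sub>1\<close> are shattered by tuples \<open>z\<close> similar to \<open>b\<close>.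
  Adding finitely many elements of \<open>B\<close> to \<open>A\<close>, which changes nothing since \<open>B\<close> is compressible over
  \<open>A\<close>, we may take \<open>k\<close> minimal, so that it no longer drops when more elements are added.

  Maximality of \<open>k\<close> means that some pattern \<open>S\<close> on \<open>y\<^sub>0,\<dots>,y\<^sub>k\<^sub>-\<^sub>1\<close> excludes further failures. Hence the formula
  \<open>\<Delta>\<^sub>S(x;y)\<close> expressing that \<open>\<Psi>(x,z)\<close> holds for some \<open>z\<close> of pattern \<open>S\<close> cannot hold at \<open>c\<close> for every
  \<open>S\<close>: it would compress. But it holds at every \<open>x\<close> satisfying \<open>\<Psi>(x,z)\<close>, for a suitable \<open>z\<close> similar to
  \<open>b\<close>. Iterating with \<open>b\<^sub>1, b\<^sub>2, \<dots>\<close> in \<open>B\<close>, each refuting all that was used before, gives arbitrarily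
  many blocks of parameters that are shattered by the finitely many formulas \<open>\<Delta>\<^sub>S\<close>, against NIP.
\<close>

section \<open>Definable relations\<close>

lemma eval_tm_map: "eval_tm M v e (map_tm f t) = eval_tm M (v \<circ> f) e t"
  by (induction t) (auto cong: map_cong simp: comp_def)

lemma sat_fm_map: "sat_fm M v e (map_fm f \<phi>) = sat_fm M (v \<circ> f) e \<phi>"
  by (induction \<phi> arbitrary: e) (simp_all add: eval_tm_map comp_def)

lemma sat_map: "sat M v (map_fm f \<phi>) = sat M (v \<circ> f) \<phi>"
  by (simp add: sat_def sat_fm_map)

lemma wf_tm_map: "wf_tm L k (map_tm f t) = wf_tm L k t"
  by (induction t) auto

lemma wf_fm_map: "wf_fm L k (map_fm f \<phi>) = wf_fm L k \<phi>"
  by (induction \<phi> arbitrary: k) (auto simp: wf_tm_map)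

lemma eval_tm_cong: "(\<And>x. x \<in> tm_vars t \<Longrightarrow> v x = v' x) \<Longrightarrow> eval_tm M v e t = eval_tm M v' e t"
proof (induction t)
  case (App f ts)
  have "map (eval_tm M v e) ts = map (eval_tm M v' e) ts"
    using App by (intro map_cong) auto
  then show ?case by (simp only: eval_tm.simps)
qed auto

lemma sat_fm_cong: "(\<And>x. x \<in> fm_vars \<phi> \<Longrightarrow> v x = v' x) \<Longrightarrow> sat_fm M v e \<phi> = sat_fm M v' e \<phi>"
proof (induction \<phi> arbitrary: e)
  case (Eq s t)
  then have "eval_tm M v e s = eval_tm M v' e s" "eval_tm M v e t = eval_tm M v' e t"
    by (auto intro: eval_tm_cong)
  then show ?case by simp
next
  case (Rel r ts)
  then have "map (eval_tm M v e) ts = map (eval_tm M v' e) ts"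
    by (intro map_cong) (auto intro: eval_tm_cong)
  then show ?case by (simp only: sat_fm.simps)
next
  case (Conj a b)
  have "sat_fm M v e a = sat_fm M v' e a" "sat_fm M v e b = sat_fm M v' e b"
    using Conj by auto
  then show ?case by simp
qed auto

lemma sat_cong: "(\<And>x. x \<in> fm_vars \<phi> \<Longrightarrow> v x = v' x) \<Longrightarrow> sat M v \<phi> = sat M v' \<phi>"
  unfolding sat_def by (rule sat_fm_cong)

lemma finite_tm_vars: "finite (tm_vars t)"
  by (induction t) auto

lemma finite_fm_vars: "finite (fm_vars \<phi>)"
  by (induction \<phi>) (auto simp: finite_tm_vars)

lemma eval_tm_env: "wf_tm L k t \<Longrightarrow> (\<And>j. j < k \<Longrightarrow> e j = e' j) \<Longrightarrow> eval_tm M v e t = eval_tm M v e' t"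
proof (induction t)
  case (App f ts)
  have "map (eval_tm M v e) ts = map (eval_tm M v e') ts"
    using App by (intro map_cong) auto
  then show ?case by (simp only: eval_tm.simps)
qed auto

lemma sat_fm_env:
  "wf_fm L k \<phi> \<Longrightarrow> (\<And>j. j < k \<Longrightarrow> e j = e' j) \<Longrightarrow> sat_fm M v e \<phi> = sat_fm M v e' \<phi>"
proof (induction \<phi> arbitrary: k e e')
  case (Eq s t)
  then have "eval_tm M v e s = eval_tm M v e' s" "eval_tm M v e t = eval_tm M v e' t"
    by (auto intro: eval_tm_env)
  then show ?case by simp
next
  case (Rel r ts)
  then have "map (eval_tm M v e) ts = map (eval_tm M v e') ts"
    by (intro map_cong) (auto intro: eval_tm_env)
  then show ?case by (simp only: sat_fm.simps)
next
  case (Neg \<phi>)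
  have "sat_fm M v e \<phi> = sat_fm M v e' \<phi>"
    using Neg.prems by (intro Neg.IH[of k]) auto
  then show ?case by simp
next
  case (Conj a b)
  have "sat_fm M v e a = sat_fm M v e' a" "sat_fm M v e b = sat_fm M v e' b"
    using Conj.prems by (auto intro!: Conj.IH[of k])
  then show ?case by simp
next
  case (Ex \<phi>)
  have "sat_fm M v (case_nat a e) \<phi> = sat_fm M v (case_nat a e') \<phi>" for a
    using Ex.prems by (intro Ex.IH[of "Suc k"]) (auto split: nat.splits)
  then show ?case by simp
qed

text \<open>Turns the free variable \<open>0\<close> into the outermost bound variable and shifts the others down.\<close>

primrec bind_tm :: "nat \<Rightarrow> ('f, nat) tm \<Rightarrow> ('f, nat) tm" where
  "bind_tm d (Var x) = (case x of 0 \<Rightarrow> Bound d | Suc i \<Rightarrow> Var i)"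
| "bind_tm d (Bound j) = Bound j"
| "bind_tm d (App f ts) = App f (map (bind_tm d) ts)"

primrec bind_fm :: "nat \<Rightarrow> ('f, 'r, nat) fm \<Rightarrow> ('f, 'r, nat) fm" where
  "bind_fm d (Eq s t) = Eq (bind_tm d s) (bind_tm d t)"
| "bind_fm d (Rel r ts) = Rel r (map (bind_tm d) ts)"
| "bind_fm d (Neg \<phi>) = Neg (bind_fm d \<phi>)"
| "bind_fm d (Conj \<phi> \<psi>) = Conj (bind_fm d \<phi>) (bind_fm d \<psi>)"
| "bind_fm d (Ex \<phi>) = Ex (bind_fm (Suc d) \<phi>)"

lemma eval_bind_tm: "eval_tm M v e (bind_tm d t) = eval_tm M (case_nat (e d) v) e t"
  by (induction t) (auto cong: map_cong split: nat.splits simp: comp_def)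

lemma sat_bind_fm: "sat_fm M v e (bind_fm d \<phi>) = sat_fm M (case_nat (e d) v) e \<phi>"
  by (induction \<phi> arbitrary: d e) (simp_all add: eval_bind_tm comp_def)

lemma wf_bind_tm: "wf_tm L d t \<Longrightarrow> wf_tm L (Suc d) (bind_tm d t)"
  by (induction t) (auto split: nat.splits)

lemma wf_bind_fm: "wf_fm L d \<phi> \<Longrightarrow> wf_fm L (Suc d) (bind_fm d \<phi>)"
  by (induction \<phi> arbitrary: d) (auto simp: wf_bind_tm)

section \<open>Finite tuples and coded infinite sequences\<close>

definition tup :: "'a set \<Rightarrow> nat \<Rightarrow> 'a list set" where
  "tup X n = {xs. set xs \<subseteq> X \<and> length xs = n}"

lemma tupI: "set xs \<subseteq> X \<Longrightarrow> length xs = n \<Longrightarrow> xs \<in> tup X n" by (simp add: tup_def)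
lemma tup_length: "xs \<in> tup X n \<Longrightarrow> length xs = n" by (simp add: tup_def)
lemma tup_subset: "xs \<in> tup X n \<Longrightarrow> set xs \<subseteq> X" by (simp add: tup_def)
lemma tup_mono: "X \<subseteq> Y \<Longrightarrow> xs \<in> tup X n \<Longrightarrow> xs \<in> tup Y n" by (auto simp: tup_def)
lemma finite_tup: "finite X \<Longrightarrow> finite (tup X n)" by (simp add: tup_def finite_lists_length_eq)

lemma tup_Suc: "tup X (Suc n) = (\<Union>x \<in> X. (#) x ` tup X n)"
  by (auto simp: tup_def length_Suc_conv)

text \<open>Nested uses, as in \<open>pre x (pre \<beta> a)\<close>, split the variables of one
  formula into an object tuple, a tuple of extra parameters and a parameter sequence, without names
  for the groups.\<close>

primrec pre :: "'a list \<Rightarrow> (nat \<Rightarrow> 'a) \<Rightarrow> nat \<Rightarrow> 'a" where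
  "pre [] e = e"
| "pre (x # xs) e = case_nat x (pre xs e)"

lemma pre_apply: "pre xs e i = (if i < length xs then xs ! i else e (i - length xs))"
  by (induction xs arbitrary: i) (auto split: nat.splits simp: less_Suc_eq_0_disj)

lemma pre_append: "pre (xs @ ys) e = pre xs (pre ys e)"
  by (induction xs) auto

lemma pre_map: "pre (map e is) (\<lambda>i. e (h i)) = (\<lambda>i. e (pre is h i))"
  by (rule ext) (simp add: pre_apply)

lemma pre_shift: "length xs = n \<Longrightarrow> (\<lambda>i. pre xs e (i + n)) = e"
  by (rule ext) (simp add: pre_apply)

lemma pre_shift_apply: "length xs = n \<Longrightarrow> pre xs e (i + n) = e i"
  by (simp add: pre_apply)

lemma map_pre: "length xs = n \<Longrightarrow> map (pre xs e) [0..<n] = xs"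
  by (rule nth_equalityI) (auto simp: pre_apply)

lemma range_pre: "set xs \<subseteq> X \<Longrightarrow> range e \<subseteq> X \<Longrightarrow> range (pre xs e) \<subseteq> X"
  by (force simp: pre_apply)

definition row :: "nat \<Rightarrow> (nat \<Rightarrow> 'a) \<Rightarrow> nat \<Rightarrow> 'a" where
  "row j e = (\<lambda>i. e (prod_encode (j, i)))"

definition mix :: "(nat \<Rightarrow> nat \<Rightarrow> 'a) \<Rightarrow> nat \<Rightarrow> 'a" where
  "mix g = (\<lambda>k. g (fst (prod_decode k)) (snd (prod_decode k)))"

lemma row_mix [simp]: "row j (mix g) = g j"
  by (simp add: row_def mix_def)

lemma range_mix: "(\<And>j. range (g j) \<subseteq> X) \<Longrightarrow> range (mix g) \<subseteq> X"
  by (auto simp: mix_def)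

text \<open>
  Parameters are infinite sequences, of which a formula reads finitely many entries; \<open>row\<close> and \<open>mix\<close> code
  a sequence of sequences into one. Every way of reading parameters from an assignment is a
  reindexing, so it is absorbed by renaming the free variables.
\<close>

definition reindexing :: "((nat \<Rightarrow> 'a) \<Rightarrow> nat \<Rightarrow> 'a) \<Rightarrow> bool" where
  "reindexing T \<longleftrightarrow> (\<exists>h. \<forall>e. T e = (\<lambda>i. e (h i)))"

definition list_reindexing :: "nat \<Rightarrow> ((nat \<Rightarrow> 'a) \<Rightarrow> 'a list) \<Rightarrow> bool" where
  "list_reindexing n X \<longleftrightarrow> (\<exists>is. length is = n \<and> (\<forall>e. X e = map e is))"

lemma reindexing_id: "reindexing (\<lambda>e. e)" unfolding reindexing_def by (rule exI[of _ "\<lambda>i. i"]) simp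

lemma reindexing_reindex: "reindexing T \<Longrightarrow> reindexing (\<lambda>e i. T e (g i))"
  unfolding reindexing_def by (elim exE, rule_tac x="\<lambda>i. h (g i)" in exI) simp

lemma reindexing_row: "reindexing T \<Longrightarrow> reindexing (\<lambda>e. row j (T e))"
  unfolding row_def by (rule reindexing_reindex)

lemma reindexing_pre: "list_reindexing n X \<Longrightarrow> reindexing T \<Longrightarrow> reindexing (\<lambda>e. pre (X e) (T e))"
  unfolding reindexing_def list_reindexing_def by (elim exE conjE, rule_tac x="pre is h" in exI) (simp add: pre_map)

lemma list_reindexing_map: "reindexing T \<Longrightarrow> length is = n \<Longrightarrow> list_reindexing n (\<lambda>e. map (T e) is)"
  unfolding reindexing_def list_reindexing_def by (elim exE, rule_tac x="map h is" in exI) simp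

lemma list_reindexing_comp: "list_reindexing n X \<Longrightarrow> reindexing T \<Longrightarrow> list_reindexing n (\<lambda>e. X (T e))"
  unfolding reindexing_def list_reindexing_def
  by (elim exE conjE, rule_tac x="map h is" in exI) simp

lemma reindexing_comp: "reindexing S \<Longrightarrow> reindexing T \<Longrightarrow> reindexing (\<lambda>e. S (T e))"
  unfolding reindexing_def by (elim exE, rule_tac x="\<lambda>i. ha (h i)" in exI) simp

lemma reindexing_shift: "reindexing (\<lambda>e i. e (h i))"
  unfolding reindexing_def by blast

lemmas reindexing_rules = reindexing_pre list_reindexing_map reindexing_row reindexing_id reindexing_shift

section \<open>Closure properties of definable relations\<close>

locale definability =
  fixes L :: "('f, 'r) fo_language" and U :: "('f, 'r, 'a) fo_structure"
begin

text \<open>Relations on infinite assignments stand in for formulas, so that bookkeeping of free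
  variables reduces to closure properties. Agreement is demanded only on assignments into the model,
  where the quantifiers range. No parameters are hidden in the formula: all of them enter through
  the assignment.\<close>

definition dfn :: "((nat \<Rightarrow> 'a) \<Rightarrow> bool) \<Rightarrow> bool" where
  "dfn P \<longleftrightarrow> (\<exists>\<phi> :: ('f, 'r, nat) fm. wf_fm L 0 \<phi> \<and> (\<forall>e. range e \<subseteq> univ U \<longrightarrow> (P e \<longleftrightarrow> sat U e \<phi>)))"

lemma dfn_not: "dfn P \<Longrightarrow> dfn (\<lambda>e. \<not> P e)"
  unfolding dfn_def by (elim exE conjE, rule_tac x="Neg \<phi>" in exI) (simp add: sat_def)

lemma dfn_conj: "dfn P \<Longrightarrow> dfn Q \<Longrightarrow> dfn (\<lambda>e. P e \<and> Q e)"
  unfolding dfn_def by (elim exE conjE, rule_tac x="Conj \<phi> \<phi>'" in exI) (simp add: sat_def)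

lemma dfn_iff_const: "dfn P \<Longrightarrow> dfn (\<lambda>e. P e \<longleftrightarrow> b)"
  by (cases b) (simp_all add: dfn_not)

lemma dfn_True: "dfn (\<lambda>e. True)"
  unfolding dfn_def
  by (rule exI[of _ "Neg (Ex (Neg (Eq (Bound 0) (Bound 0))))"]) (simp add: sat_def)

lemma dfn_eq: "dfn (\<lambda>e. e i = e j)"
  unfolding dfn_def by (rule exI[of _ "Eq (Var i) (Var j)"]) (simp add: sat_def)

lemma dfn_reindexing: "dfn P \<Longrightarrow> reindexing T \<Longrightarrow> dfn (\<lambda>e. P (T e))"
proof -
  assume "dfn P" "reindexing T"
  then obtain \<phi> :: "('f, 'r, nat) fm" and h where \<phi>: "wf_fm L 0 \<phi>"
      "\<And>e. range e \<subseteq> univ U \<Longrightarrow> P e = sat U e \<phi>" and h: "\<And>e. T e = (\<lambda>i. e (h i))"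
    unfolding dfn_def reindexing_def by auto
  have "P (T e) = sat U e (map_fm h \<phi>)" if "range e \<subseteq> univ U" for e
    using that by (subst \<phi>(2)) (auto simp: h sat_map comp_def)
  then show ?thesis
    unfolding dfn_def using \<phi>(1) by (intro exI[of _ "map_fm h \<phi>"]) (auto simp: wf_fm_map)
qed

lemma dfn_ball: "finite S \<Longrightarrow> (\<And>s. s \<in> S \<Longrightarrow> dfn (P s)) \<Longrightarrow> dfn (\<lambda>e. \<forall>s \<in> S. P s e)"
  by (induction S rule: finite_induct) (auto simp: dfn_True intro!: dfn_conj)

lemma dfn_all_less: "(\<And>j. j < k \<Longrightarrow> dfn (P j)) \<Longrightarrow> dfn (\<lambda>e. \<forall>j<k. P j e)" for k :: nat
  using dfn_ball[of "{..<k}" P] by (simp add: Ball_def lessThan_iff)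

lemma dfn_ex1:
  assumes "dfn P" shows "dfn (\<lambda>e. \<exists>x \<in> univ U. P (case_nat x e))"
proof -
  obtain \<phi> :: "('f, 'r, nat) fm" where \<phi>: "wf_fm L 0 \<phi>"
      "\<And>e. range e \<subseteq> univ U \<Longrightarrow> P e = sat U e \<phi>"
    using assms unfolding dfn_def by auto
  have "(\<exists>x \<in> univ U. P (case_nat x e)) = sat U e (Ex (bind_fm 0 \<phi>))" if "range e \<subseteq> univ U" for e
  proof -
    \<comment> \<open>The formula has no dangling index, so putting \<open>x\<close> into the
      environment changes nothing until \<open>bind_fm\<close> makes a variable read it.\<close>
    have "P (case_nat x e) = sat_fm U e (case_nat x (\<lambda>_. undefined)) (bind_fm 0 \<phi>)"
      if "x \<in> univ U" for x
    proof -
      have "range (case_nat x e) \<subseteq> univ U"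
        using that \<open>range e \<subseteq> univ U\<close> by (auto simp: image_subset_iff split: nat.splits)
      then have "P (case_nat x e) = sat_fm U (case_nat x e) (\<lambda>_. undefined) \<phi>"
        by (simp add: \<phi>(2) sat_def)
      also have "\<dots> = sat_fm U (case_nat x e) (case_nat x (\<lambda>_. undefined)) \<phi>"
        by (rule sat_fm_env[OF \<phi>(1)]) simp
      finally show ?thesis by (simp add: sat_bind_fm)
    qed
    then show ?thesis by (simp add: sat_def)
  qed
  then show ?thesis
    unfolding dfn_def using \<phi>(1) by (intro exI[of _ "Ex (bind_fm 0 \<phi>)"]) (auto simp: wf_bind_fm)
qed

lemma dfn_ex_pre: "dfn P \<Longrightarrow> dfn (\<lambda>e. \<exists>xs \<in> tup (univ U) n. P (pre xs e))"
proof (induction n arbitrary: P)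
  case 0
  then show ?case by (simp add: tup_def)
next
  case (Suc n)
  have "(\<exists>xs \<in> tup (univ U) (Suc n). P (pre xs e)) \<longleftrightarrow>
        (\<exists>xs \<in> tup (univ U) n. \<exists>x \<in> univ U. P (case_nat x (pre xs e)))" for e
    by (auto simp: tup_Suc)
  then show ?case using Suc.IH[OF dfn_ex1[OF Suc.prems]] by simp
qed

text \<open>The hypothesis reads the bound tuple from the first \<open>n\<close> entries and moves
  the old assignment behind it, so that nested quantifiers are handled by repeated
  introduction.\<close>

lemma dfn_ex:
  assumes "dfn (\<lambda>e. Q (map e [0..<n]) (\<lambda>i. e (i + n)))"
  shows "dfn (\<lambda>e. \<exists>x \<in> tup (univ U) n. Q x e)"
proof -
  have "(\<exists>xs \<in> tup (univ U) n. Q (map (pre xs e) [0..<n]) (\<lambda>i. pre xs e (i + n)))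
      = (\<exists>x \<in> tup (univ U) n. Q x e)" for e
    by (rule bex_cong) (auto dest: tup_length simp: map_pre pre_shift)
  then show ?thesis using dfn_ex_pre[OF assms, of n] by simp
qed

text \<open>Quantifying over all ways of reading the two tuples from an assignment builds
  substitution into the notion, which lets such a relation occur under quantifiers.\<close>

definition dfn2 :: "nat \<Rightarrow> nat \<Rightarrow> ('a list \<Rightarrow> 'a list \<Rightarrow> bool) \<Rightarrow> bool" where
  "dfn2 l n R \<longleftrightarrow> (\<forall>X Y. list_reindexing l X \<longrightarrow> list_reindexing n Y \<longrightarrow> dfn (\<lambda>e. R (X e) (Y e)))"

lemma dfn2D: "dfn2 l n R \<Longrightarrow> list_reindexing l X \<Longrightarrow> list_reindexing n Y \<Longrightarrow> dfn (\<lambda>e. R (X e) (Y e))"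
  unfolding dfn2_def by auto

text \<open>A formula has finitely many free variables; this later lets an infinite parameter
  sequence be replaced by one with finite range.\<close>

lemma dfn_support: "dfn P \<Longrightarrow> \<exists>k. \<forall>e e'. range e \<subseteq> univ U \<longrightarrow> range e' \<subseteq> univ U \<longrightarrow> (\<forall>i<k. e i = e' i) \<longrightarrow> P e = P e'"
proof -
  assume "dfn P"
  then obtain \<phi> :: "('f, 'r, nat) fm" where \<phi>:
      "\<And>e. range e \<subseteq> univ U \<Longrightarrow> P e = sat U e \<phi>"
    unfolding dfn_def by auto
  obtain k where "\<forall>i \<in> fm_vars \<phi>. i < k"
    using finite_fm_vars[of \<phi>] finite_nat_set_iff_bounded by auto
  then show ?thesis by (intro exI[of _ k]) (auto simp: \<phi> intro!: sat_cong)
qed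

end

section \<open>Breaking compression\<close>

text \<open>One formula \<open>\<phi>(x,y)\<close> and one finite tuple \<open>c\<close> are treated
  at a time, and only the false instances are to be compressed; the true ones are handled by the
  negation of \<open>\<phi>\<close>. \<open>compress_c\<close> stems from compressibility of
  \<open>C\<close> over \<open>B\<close>, \<open>compress_B\<close> from that of \<open>B\<close>
  over \<open>A\<close>. A nonempty \<open>A\<close> supplies infinite sequences of
  parameters.\<close>

locale compression = definability L U
  for L :: "('f, 'r) fo_language" and U :: "('f, 'r, 'a) fo_structure" +
  fixes A B :: "'a set" and l n m :: nat and c :: "'a list" and \<phi> \<Psi> :: "'a list \<Rightarrow> 'a list \<Rightarrow> bool"
  assumes nip: "\<And>R r. dfn R \<Longrightarrow> \<exists>d. \<forall>(N::nat) vs. (\<forall>j<N. range (vs j) \<subseteq> univ U) \<longrightarrow>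
      (\<forall>S \<subseteq> {..<N}. \<exists>x \<in> tup (univ U) r. \<forall>j<N. R (pre x (vs j)) \<longleftrightarrow> j \<in> S) \<longrightarrow> N \<le> d"
    and A_nonempty: "A \<noteq> {}" and A_B: "A \<subseteq> B" and B_U: "B \<subseteq> univ U"
    and c: "c \<in> tup (univ U) l"
    and \<phi>: "dfn2 l n \<phi>" and \<Psi>: "dfn2 l m \<Psi>"
    and compress_c: "\<And>A\<^sub>0. finite A\<^sub>0 \<Longrightarrow> A\<^sub>0 \<subseteq> A \<Longrightarrow> \<exists>b \<in> tup B m. \<Psi> c b \<and>
      (\<forall>x \<in> tup (univ U) l. \<Psi> x b \<longrightarrow> (\<forall>y \<in> tup A\<^sub>0 n. \<not> \<phi> c y \<longrightarrow> \<not> \<phi> x y))"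
    and compress_B: "\<And>b R. set b \<subseteq> B \<Longrightarrow> dfn R \<Longrightarrow> \<exists>\<rho>. dfn \<rho> \<and>
      (\<forall>A\<^sub>0. finite A\<^sub>0 \<longrightarrow> A\<^sub>0 \<subseteq> A \<longrightarrow> (\<exists>w. range w \<subseteq> A \<and> \<rho> (pre b w) \<and>
        (\<forall>z \<in> tup (univ U) (length b). \<rho> (pre z w) \<longrightarrow>
          (\<forall>y. range y \<subseteq> A\<^sub>0 \<longrightarrow> (R (pre z y) \<longleftrightarrow> R (pre b y))))))"
begin

abbreviation (input) "M \<equiv> univ U"

definition \<theta> :: "'a list \<Rightarrow> 'a list \<Rightarrow> bool" where
  "\<theta> z y \<longleftrightarrow> (\<exists>x \<in> tup M l. \<Psi> x z \<and> \<phi> x y)"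

definition Y :: "'a list set" where
  "Y = {y \<in> tup A n. \<not> \<phi> c y}"

text \<open>Failure of \<open>\<theta> b y\<close> says that \<open>\<Psi>(x,b)\<close> implies the
  negation of \<open>\<phi>(x,y)\<close>; a good tuple thus compresses the instances in
  \<open>Z\<close>.\<close>

definition good :: "'a list set \<Rightarrow> 'a list \<Rightarrow> bool" where
  "good Z b \<longleftrightarrow> \<Psi> c b \<and> (\<forall>y \<in> Z. \<not> \<theta> b y)"

definition shattered :: "('a list \<Rightarrow> bool) \<Rightarrow> nat \<Rightarrow> (nat \<Rightarrow> 'a list) \<Rightarrow> bool" where
  "shattered P k ys \<longleftrightarrow> (\<forall>S \<subseteq> {..<k}. \<exists>z \<in> tup M m. P z \<and> (\<forall>j<k. \<theta> z (ys j) \<longleftrightarrow> j \<in> S))"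

text \<open>
  A tuple \<open>b\<close> that refutes \<open>\<phi>\<close> on a large finite set \<open>Z\<close> cannot be told apart, by one formula over \<open>A\<close> and
  \<open>\<beta>\<close>, from tuples with all possible \<open>\<theta>\<close>-patterns on some \<open>k\<close> elements of \<open>Z\<close>. That \<open>Z\<close> depends only on the
  formula, not on \<open>b\<close> and the parameters \<open>a\<close>, is what lets the breaks be iterated.
\<close>

definition breakable :: "nat \<Rightarrow> 'a list \<Rightarrow> bool" where
  "breakable k \<beta> \<longleftrightarrow> (\<forall>\<chi>. dfn \<chi> \<longrightarrow> (\<exists>Z \<subseteq> Y. finite Z \<and> (\<forall>b \<in> tup B m. good Z b \<longrightarrow>
     (\<forall>a. range a \<subseteq> A \<longrightarrow> \<chi> (pre b (pre \<beta> a)) \<longrightarrow>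
       (\<exists>ys. (\<forall>j<k. ys j \<in> Z) \<and> shattered (\<lambda>z. \<chi> (pre z (pre \<beta> a))) k ys)))))"

lemma A_U: "A \<subseteq> M" using A_B B_U by auto

lemma dfn2_\<theta>: "dfn2 m n \<theta>"
  unfolding dfn2_def \<theta>_def
proof (intro allI impI)
  fix X Y :: "(nat \<Rightarrow> 'a) \<Rightarrow> 'a list"
  assume "list_reindexing m X" "list_reindexing n Y"
  then show "dfn (\<lambda>e. \<exists>x \<in> tup M l. \<Psi> x (X e) \<and> \<phi> x (Y e))"
    by (intro dfn_ex dfn_conj dfn2D[OF \<Psi>] dfn2D[OF \<phi>] list_reindexing_map reindexing_id)
      (auto intro: list_reindexing_comp reindexing_shift)
qed

lemma exists_good:
  assumes "finite Z" "Z \<subseteq> Y" shows "\<exists>b \<in> tup B m. good Z b"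
proof -
  have "finite (\<Union>y\<in>Z. set y)" "(\<Union>y\<in>Z. set y) \<subseteq> A"
    using assms by (auto simp: Y_def dest: tup_subset)
  from compress_c[OF this] obtain b where b: "b \<in> tup B m" "\<Psi> c b"
    "\<And>x y. x \<in> tup M l \<Longrightarrow> \<Psi> x b \<Longrightarrow> y \<in> tup (\<Union>y\<in>Z. set y) n \<Longrightarrow> \<not> \<phi> c y \<Longrightarrow> \<not> \<phi> x y"
    by blast
  have "y \<in> tup (\<Union>y\<in>Z. set y) n \<and> \<not> \<phi> c y" if "y \<in> Z" for y
    using that assms by (auto simp: Y_def tup_def)
  then have "good Z b"
    using b(2,3) by (auto simp: good_def \<theta>_def)
  then show ?thesis using b(1) by blast
qed

text \<open>By \<open>compress_B\<close>, the tuple \<open>\<beta>\<close> can be traded for a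
  variable \<open>z\<close> subject to a formula over \<open>A\<close>. A formula over
  \<open>A\<close> and \<open>\<beta>\<close> that compressed the instances would then give one over
  \<open>A\<close> alone. The finite set \<open>Y\<^sub>0\<close> belongs to the new formula, hence
  is independent of \<open>a\<close>.\<close>

lemma noncompress_over:
  assumes nc: "\<And>\<psi>. dfn \<psi> \<Longrightarrow> \<exists>A\<^sub>0. finite A\<^sub>0 \<and> A\<^sub>0 \<subseteq> A \<and> (\<forall>a. range a \<subseteq> A \<longrightarrow> \<psi> (pre c a) \<longrightarrow>
      (\<exists>y \<in> tup A\<^sub>0 n. \<not> \<phi> c y \<and> (\<exists>x \<in> tup M l. \<psi> (pre x a) \<and> \<phi> x y)))"
    and \<beta>: "set \<beta> \<subseteq> B" and \<psi>: "dfn \<psi>"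
  shows "\<exists>Y\<^sub>0 \<subseteq> Y. finite Y\<^sub>0 \<and> (\<forall>a. range a \<subseteq> A \<longrightarrow> \<psi> (pre c (pre \<beta> a)) \<longrightarrow>
      (\<exists>y \<in> Y\<^sub>0. \<exists>x \<in> tup M l. \<psi> (pre x (pre \<beta> a)) \<and> \<phi> x y))"
proof -
  define r where "r = length \<beta>"
  \<comment> \<open>\<open>R\<close> holds of \<open>z\<close> if \<open>\<psi>(x,z,a)\<close> is
    consistent with \<open>\<phi>(x,y)\<close>; row 0 of its parameters holds \<open>a\<close>, row
    1 begins with \<open>y\<close>.\<close>
  define R where "R = (\<lambda>e. \<exists>x \<in> tup M l. \<psi> (pre x (pre (map e [0..<r]) (row 0 (\<lambda>i. e (i + r)))))
    \<and> \<phi> x (map (row 1 (\<lambda>i. e (i + r))) [0..<n]))"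
  have R: "dfn R"
    unfolding R_def
    by (intro dfn_ex dfn_conj dfn_reindexing[OF \<psi>] dfn2D[OF \<phi>] reindexing_rules) simp_all
  obtain \<rho> where \<rho>: "dfn \<rho>" and compress_\<beta>: "\<forall>A\<^sub>0. finite A\<^sub>0 \<longrightarrow> A\<^sub>0 \<subseteq> A \<longrightarrow> (\<exists>w. range w \<subseteq> A \<and> \<rho> (pre \<beta> w) \<and>
        (\<forall>z \<in> tup M r. \<rho> (pre z w) \<longrightarrow> (\<forall>y. range y \<subseteq> A\<^sub>0 \<longrightarrow> (R (pre z y) \<longleftrightarrow> R (pre \<beta> y)))))"
    using compress_B[OF \<beta> R] unfolding r_def[symmetric] by (elim exE conjE) (rule that)
  \<comment> \<open>The formula over \<open>A\<close> alone: \<open>\<beta>\<close> is replaced by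
    some \<open>z\<close> satisfying the compressing formula \<open>\<rho>\<close>.\<close>
  define \<psi>' where "\<psi>' = (\<lambda>e. \<exists>z \<in> tup M r. \<rho> (pre z (row 0 (\<lambda>i. e (i + l)))) \<and>
    \<psi> (pre (map e [0..<l]) (pre z (row 1 (\<lambda>i. e (i + l))))))"
  have \<psi>': "dfn \<psi>'"
    unfolding \<psi>'_def
    by (intro dfn_ex dfn_conj dfn_reindexing[OF \<psi>] dfn_reindexing[OF \<rho>] reindexing_rules) simp_all
  obtain A\<^sub>0 where A\<^sub>0: "finite A\<^sub>0" "A\<^sub>0 \<subseteq> A" and nc': "\<forall>a. range a \<subseteq> A \<longrightarrow> \<psi>' (pre c a) \<longrightarrow>
      (\<exists>y \<in> tup A\<^sub>0 n. \<not> \<phi> c y \<and> (\<exists>x \<in> tup M l. \<psi>' (pre x a) \<and> \<phi> x y))"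
    using nc[OF \<psi>'] by (elim exE conjE) (rule that)
  define Y\<^sub>0 where "Y\<^sub>0 = {y \<in> tup A\<^sub>0 n. \<not> \<phi> c y}"
  have "\<exists>y \<in> Y\<^sub>0. \<exists>x \<in> tup M l. \<psi> (pre x (pre \<beta> a)) \<and> \<phi> x y"
    if a: "range a \<subseteq> A" and ca: "\<psi> (pre c (pre \<beta> a))" for a
  proof -
    obtain K where K: "\<And>e e'. range e \<subseteq> M \<Longrightarrow> range e' \<subseteq> M \<Longrightarrow> (\<And>i. i < K \<Longrightarrow> e i = e' i) \<Longrightarrow> \<psi> e = \<psi> e'"
      using dfn_support[OF \<psi>] by blast
    \<comment> \<open>Compression of \<open>\<beta>\<close> handles only finitely many parameters
      from \<open>A\<close>, so \<open>a\<close> is cut off at a bound for the variables of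
      \<open>\<psi>\<close> and continued constantly.\<close>
    define a' where "a' = (\<lambda>i. if i < K then a i else a 0)"
    have a'_sub: "range a' \<subseteq> range a" by (auto simp: a'_def)
    have fin_a': "finite (range a')"
      by (rule finite_subset[of _ "a ` {..K}"]) (auto simp: a'_def)
    have eq: "\<psi> (pre x (pre z a')) = \<psi> (pre x (pre z a))" if "x \<in> tup M l" "z \<in> tup M r" for x z
      using that a a'_sub A_U
      by (intro K range_pre) (auto simp: pre_apply a'_def dest: tup_subset)
    have \<beta>_tup: "\<beta> \<in> tup M r" using \<beta> B_U by (auto simp: tup_def r_def)
    have "finite (A\<^sub>0 \<union> range a')" "A\<^sub>0 \<union> range a' \<subseteq> A"
      using A\<^sub>0 fin_a' a a'_sub by auto
    from compress_\<beta>[rule_format, OF this] obtain w where w: "range w \<subseteq> A" "\<rho> (pre \<beta> w)"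
      "\<And>z y. z \<in> tup M r \<Longrightarrow> \<rho> (pre z w) \<Longrightarrow> range y \<subseteq> A\<^sub>0 \<union> range a' \<Longrightarrow> R (pre z y) \<longleftrightarrow> R (pre \<beta> y)"
      by blast
    define p where "p = mix (case_nat w (\<lambda>_. a'))"
    have p: "range p \<subseteq> A"
      unfolding p_def using w(1) subset_trans[OF a'_sub a] by (intro range_mix) (auto split: nat.splits)
    have \<psi>'_iff: "\<psi>' (pre x p) \<longleftrightarrow> (\<exists>z \<in> tup M r. \<rho> (pre z w) \<and> \<psi> (pre x (pre z a')))" if "x \<in> tup M l" for x
      using that by (simp add: \<psi>'_def map_pre tup_length pre_shift p_def)
    have "\<psi>' (pre c p)"
      using w(2) ca \<beta>_tup by (auto simp: \<psi>'_iff[OF c] eq[OF c])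
    from nc'[rule_format, OF p this] obtain y x where y: "y \<in> tup A\<^sub>0 n" "\<not> \<phi> c y" and x: "x \<in> tup M l" "\<psi>' (pre x p)" "\<phi> x y"
      by blast
    then obtain z where z: "z \<in> tup M r" "\<rho> (pre z w)" "\<psi> (pre x (pre z a'))"
      using \<psi>'_iff by auto
    \<comment> \<open>Filling up with \<open>a'\<close> keeps every entry in the finite set over
      which \<open>\<rho>\<close> decides \<open>R\<close>.\<close>
    define q where "q = mix (case_nat a' (\<lambda>_. pre y a'))"
    have q: "range q \<subseteq> A\<^sub>0 \<union> range a'"
      unfolding q_def
    proof (rule range_mix)
      fix j show "range (case_nat a' (\<lambda>_. pre y a') j) \<subseteq> A\<^sub>0 \<union> range a'"
        using tup_subset[OF y(1)] by (cases j) (auto simp: pre_apply set_conv_nth)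
    qed
    have R_iff: "R (pre z q) \<longleftrightarrow> (\<exists>x \<in> tup M l. \<psi> (pre x (pre z a')) \<and> \<phi> x y)" if "z \<in> tup M r" for z
      using that y(1) by (simp add: R_def map_pre tup_length pre_shift q_def)
    \<comment> \<open>\<open>x\<close> witnesses \<open>R\<close> at \<open>z\<close>; as
      \<open>z\<close> satisfies \<open>\<rho>\<close>, the relation transfers to
      \<open>\<beta>\<close>.\<close>
    have "R (pre \<beta> q)"
      using w(3)[OF z(1,2) q] R_iff[OF z(1)] x z by auto
    then show ?thesis
      using R_iff[OF \<beta>_tup] eq \<beta>_tup y by (auto simp: Y\<^sub>0_def)
  qed
  moreover have "Y\<^sub>0 \<subseteq> Y" "finite Y\<^sub>0"
    using A\<^sub>0 by (auto simp: Y_def Y\<^sub>0_def finite_tup intro: tup_mono)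
  ultimately show ?thesis by blast
qed

section \<open>Breakable and unbreakable depths\<close>

lemma breakableE:
  assumes "breakable k \<beta>" "dfn \<chi>"
  obtains Z where "Z \<subseteq> Y" "finite Z"
    "\<forall>b \<in> tup B m. good Z b \<longrightarrow> (\<forall>a. range a \<subseteq> A \<longrightarrow> \<chi> (pre b (pre \<beta> a)) \<longrightarrow>
      (\<exists>ys. (\<forall>j<k. ys j \<in> Z) \<and> shattered (\<lambda>z. \<chi> (pre z (pre \<beta> a))) k ys))"
  using assms(1)[unfolded breakable_def, THEN spec, THEN mp, OF assms(2)] by (elim exE conjE) (rule that)

lemma not_breakableE:
  assumes "\<not> breakable k \<beta>"
  obtains \<chi> where "dfn \<chi>" "\<And>Z. Z \<subseteq> Y \<Longrightarrow> finite Z \<Longrightarrow> \<exists>b a. b \<in> tup B m \<and> good Z b \<and> range a \<subseteq> A \<and>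
      \<chi> (pre b (pre \<beta> a)) \<and> (\<forall>ys. (\<forall>j<k. ys j \<in> Z) \<longrightarrow> \<not> shattered (\<lambda>z. \<chi> (pre z (pre \<beta> a))) k ys)"
proof -
  from assms obtain \<chi> where "dfn \<chi> \<and> \<not> (\<exists>Z \<subseteq> Y. finite Z \<and> (\<forall>b \<in> tup B m. good Z b \<longrightarrow>
     (\<forall>a. range a \<subseteq> A \<longrightarrow> \<chi> (pre b (pre \<beta> a)) \<longrightarrow>
       (\<exists>ys. (\<forall>j<k. ys j \<in> Z) \<and> shattered (\<lambda>z. \<chi> (pre z (pre \<beta> a))) k ys))))"
    unfolding breakable_def by (simp only: not_all not_imp) (elim exE)
  then have \<chi>: "dfn \<chi>" and *: "\<not> (\<exists>Z \<subseteq> Y. finite Z \<and> (\<forall>b \<in> tup B m. good Z b \<longrightarrow>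
     (\<forall>a. range a \<subseteq> A \<longrightarrow> \<chi> (pre b (pre \<beta> a)) \<longrightarrow>
       (\<exists>ys. (\<forall>j<k. ys j \<in> Z) \<and> shattered (\<lambda>z. \<chi> (pre z (pre \<beta> a))) k ys))))"
    by (rule conjunct1, rule conjunct2)
  show thesis
  proof (rule that[OF \<chi>])
    fix Z assume "Z \<subseteq> Y" "finite Z"
    then have "\<not> (\<forall>b \<in> tup B m. good Z b \<longrightarrow> (\<forall>a. range a \<subseteq> A \<longrightarrow> \<chi> (pre b (pre \<beta> a)) \<longrightarrow>
       (\<exists>ys. (\<forall>j<k. ys j \<in> Z) \<and> shattered (\<lambda>z. \<chi> (pre z (pre \<beta> a))) k ys)))"
      using * by blast
    then show "\<exists>b a. b \<in> tup B m \<and> good Z b \<and> range a \<subseteq> A \<and>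
      \<chi> (pre b (pre \<beta> a)) \<and> (\<forall>ys. (\<forall>j<k. ys j \<in> Z) \<longrightarrow> \<not> shattered (\<lambda>z. \<chi> (pre z (pre \<beta> a))) k ys)"
      by meson
  qed
qed

text \<open>Only the empty pattern must be realised, and \<open>b\<close> itself does so with
  \<open>Z\<close> empty.\<close>

lemma breakable_0: "breakable 0 \<beta>"
  unfolding breakable_def shattered_def
proof (intro allI impI exI[of _ "{}"] conjI ballI)
  fix \<chi> :: "(nat \<Rightarrow> 'a) \<Rightarrow> bool" and b a
  assume "b \<in> tup B m" "\<chi> (pre b (pre \<beta> a))"
  then show "\<exists>ys. (\<forall>j<(0::nat). ys j \<in> {}) \<and>
      (\<forall>S\<subseteq>{..<0}. \<exists>z\<in>tup M m. \<chi> (pre z (pre \<beta> a)) \<and> (\<forall>j<0. \<theta> z (ys j) \<longleftrightarrow> j \<in> S))"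
    using tup_mono[OF B_U] by auto
qed auto

text \<open>Already for the trivially true formula, breaking to depth \<open>k\<close> makes
  \<open>\<theta>\<close> shatter \<open>k\<close> tuples, a number that NIP bounds.\<close>

lemma not_breakable_large: "\<exists>k. \<not> breakable (Suc k) []"
proof -
  have "dfn (\<lambda>e. \<theta> (map e [0..<m]) (map (\<lambda>i. e (i + m)) [0..<n]))"
    by (intro dfn2D[OF dfn2_\<theta>] reindexing_rules) simp_all
  from nip[OF this, of m] obtain d where d: "\<And>(N::nat) vs. (\<And>j. j < N \<Longrightarrow> range (vs j) \<subseteq> M) \<Longrightarrow>
      (\<And>S. S \<subseteq> {..<N} \<Longrightarrow> \<exists>z \<in> tup M m. \<forall>j<N. \<theta> (map (pre z (vs j)) [0..<m])
         (map (\<lambda>i. pre z (vs j) (i + m)) [0..<n]) \<longleftrightarrow> j \<in> S) \<Longrightarrow> N \<le> d"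
    by blast
  obtain a\<^sub>0 where a\<^sub>0: "a\<^sub>0 \<in> A" using A_nonempty by auto
  have "\<not> breakable (Suc d) []"
  proof
    assume "breakable (Suc d) []"
    then obtain Z where Z: "Z \<subseteq> Y" "finite Z"
      "\<forall>b \<in> tup B m. good Z b \<longrightarrow> (\<forall>a::nat \<Rightarrow> 'a. range a \<subseteq> A \<longrightarrow> True \<longrightarrow>
        (\<exists>ys. (\<forall>j<Suc d. ys j \<in> Z) \<and> shattered (\<lambda>z. True) (Suc d) ys))"
      by (rule breakableE[OF _ dfn_True]) (rule that)
    obtain b where b: "b \<in> tup B m" "good Z b" using exists_good[OF Z(2,1)] by blast
    have "range (\<lambda>_. a\<^sub>0) \<subseteq> A" using a\<^sub>0 by auto
    from Z(3)[rule_format, OF b this] obtain ys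
      where ys: "\<And>j. j < Suc d \<Longrightarrow> ys j \<in> Z" "shattered (\<lambda>z. True) (Suc d) ys" by auto
    have ys_tup: "ys j \<in> tup A n" if "j < Suc d" for j
      using ys(1)[OF that] Z by (auto simp: Y_def)
    have "Suc d \<le> d"
    proof (rule d[of _ "\<lambda>j. pre (ys j) (\<lambda>_. a\<^sub>0)"])
      fix j assume "j < Suc d"
      then show "range (pre (ys j) (\<lambda>_. a\<^sub>0)) \<subseteq> M"
        using ys_tup[of j] a\<^sub>0 A_U by (intro range_pre) (auto dest: tup_subset)
    next
      fix S assume "S \<subseteq> {..<Suc d}"
      from ys(2)[unfolded shattered_def, rule_format, OF this]
      obtain z where "z \<in> tup M m" "\<forall>j<Suc d. \<theta> z (ys j) \<longleftrightarrow> j \<in> S"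
        by (elim bexE conjE) (rule that)
      then show "\<exists>z\<in>tup M m. \<forall>j<Suc d.
          \<theta> (map (pre z (pre (ys j) (\<lambda>_. a\<^sub>0))) [0..<m])
            (map (\<lambda>i. pre z (pre (ys j) (\<lambda>_. a\<^sub>0)) (i + m)) [0..<n]) \<longleftrightarrow> j \<in> S"
        using map_pre[OF tup_length[OF ys_tup]]
        by (intro bexI[of _ z]) (auto simp: map_pre tup_length pre_shift)
    qed
    then show False by simp
  qed
  then show ?thesis by blast
qed

end

section \<open>The critical depth\<close>

text \<open>The situation reached when compression fails: \<open>\<beta>\<^sub>0\<close> and
  \<open>\<chi>\<^sub>0\<close> witness that depth \<open>Suc k\<close> is not breakable, while
  minimality of \<open>k\<close> makes depth \<open>k\<close> breakable for every
  \<open>\<beta>\<close> from \<open>B\<close>. So parameters from \<open>B\<close> may be added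
  freely at depth \<open>k\<close>.\<close>

locale critical_depth = compression L U A B l n m c \<phi> \<Psi>
  for L :: "('f, 'r) fo_language" and U :: "('f, 'r, 'a) fo_structure"
    and A B :: "'a set" and l n m :: nat and c :: "'a list" and \<phi> \<Psi> :: "'a list \<Rightarrow> 'a list \<Rightarrow> bool" +
  fixes k :: nat and \<beta>\<^sub>0 :: "'a list" and \<chi>\<^sub>0 :: "(nat \<Rightarrow> 'a) \<Rightarrow> bool"
  assumes noncompress: "\<And>\<psi>. dfn \<psi> \<Longrightarrow> \<exists>A\<^sub>0. finite A\<^sub>0 \<and> A\<^sub>0 \<subseteq> A \<and> (\<forall>a. range a \<subseteq> A \<longrightarrow> \<psi> (pre c a) \<longrightarrow>
      (\<exists>y \<in> tup A\<^sub>0 n. \<not> \<phi> c y \<and> (\<exists>x \<in> tup (univ U) l. \<psi> (pre x a) \<and> \<phi> x y)))"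
    and \<beta>\<^sub>0: "set \<beta>\<^sub>0 \<subseteq> B" and \<chi>\<^sub>0: "dfn \<chi>\<^sub>0"
    and breakable_k: "\<And>\<beta>. set \<beta> \<subseteq> B \<Longrightarrow> breakable k \<beta>"
    and not_breakable_Suc_k: "\<And>Z. Z \<subseteq> Y \<Longrightarrow> finite Z \<Longrightarrow> \<exists>b a. b \<in> tup B m \<and> good Z b \<and> range a \<subseteq> A \<and>
      \<chi>\<^sub>0 (pre b (pre \<beta>\<^sub>0 a)) \<and>
      (\<forall>ys. (\<forall>j<Suc k. ys j \<in> Z) \<longrightarrow> \<not> shattered (\<lambda>z. \<chi>\<^sub>0 (pre z (pre \<beta>\<^sub>0 a))) (Suc k) ys)"
begin

text \<open>The tuple \<open>b\<close> takes the place of \<open>\<beta>\<^sub>0\<close> and is kept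
  as an argument so that the relation is parameter-free. Row 0 of \<open>q\<close> holds the
  parameters of \<open>\<chi>\<^sub>0\<close>, row \<open>Suc j\<close> the tuple
  \<open>y\<^sub>j\<close>.\<close>

definition \<Delta> :: "nat set \<Rightarrow> 'a list \<Rightarrow> 'a list \<Rightarrow> (nat \<Rightarrow> 'a) \<Rightarrow> bool" where
  "\<Delta> S b x q \<longleftrightarrow> (\<exists>z \<in> tup M m. \<Psi> x z \<and> \<chi>\<^sub>0 (pre z (pre b (row 0 q))) \<and>
     (\<forall>j<k. \<theta> z (map (row (Suc j) q) [0..<n]) \<longleftrightarrow> j \<in> S))"

definition a\<^sub>0 :: 'a where "a\<^sub>0 = (SOME a. a \<in> A)"

lemma a\<^sub>0: "a\<^sub>0 \<in> A" unfolding a\<^sub>0_def using A_nonempty by (simp add: some_in_eq)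

text \<open>The remaining positions get a fixed element of \<open>A\<close>, so that the sequence
  stays in \<open>A\<close> and depends on \<open>ys\<close> only below \<open>k\<close>.\<close>

definition block :: "(nat \<Rightarrow> 'a) \<Rightarrow> (nat \<Rightarrow> 'a list) \<Rightarrow> nat \<Rightarrow> 'a" where
  "block a ys = mix (case_nat a (\<lambda>j. if j < k then pre (ys j) (\<lambda>_. a\<^sub>0) else (\<lambda>_. a\<^sub>0)))"

lemma \<Delta>_block:
  assumes "\<And>j. j < k \<Longrightarrow> ys j \<in> tup A n"
  shows "\<Delta> S b x (block a ys) \<longleftrightarrow> (\<exists>z \<in> tup M m. \<Psi> x z \<and> \<chi>\<^sub>0 (pre z (pre b a)) \<and>
     (\<forall>j<k. \<theta> z (ys j) \<longleftrightarrow> j \<in> S))"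
  using map_pre[OF tup_length[OF assms]] by (simp add: \<Delta>_def block_def cong: conj_cong)

lemma range_block:
  assumes "range a \<subseteq> A" "\<And>j. j < k \<Longrightarrow> ys j \<in> tup A n"
  shows "range (block a ys) \<subseteq> A"
  unfolding block_def
proof (rule range_mix)
  fix j
  show "range (case_nat a (\<lambda>j. if j < k then pre (ys j) (\<lambda>_. a\<^sub>0) else (\<lambda>_. a\<^sub>0)) j) \<subseteq> A"
  proof (cases j)
    case (Suc i)
    have "range (pre (ys i) (\<lambda>_. a\<^sub>0)) \<subseteq> A" if "i < k"
      using assms(2)[OF that] a\<^sub>0 by (intro range_pre) (auto dest: tup_subset)
    then show ?thesis using Suc a\<^sub>0 by auto
  qed (use assms in auto)
qed

lemma dfn_\<Delta>:
  fixes X Z :: "(nat \<Rightarrow> 'a) \<Rightarrow> 'a list"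
  assumes X: "list_reindexing l X" and Z: "list_reindexing (length \<beta>\<^sub>0) Z" and Q: "reindexing Q"
  shows "dfn (\<lambda>e. \<Delta> S (Z e) (X e) (Q e))"
proof -
  have shift: "list_reindexing l (\<lambda>e. X (\<lambda>i. e (i + m)))" "list_reindexing (length \<beta>\<^sub>0) (\<lambda>e. Z (\<lambda>i. e (i + m)))"
      "reindexing (\<lambda>e. Q (\<lambda>i. e (i + m)))"
    using list_reindexing_comp[OF X reindexing_shift] list_reindexing_comp[OF Z reindexing_shift] reindexing_comp[OF Q reindexing_shift] by auto
  show ?thesis
    unfolding \<Delta>_def
    by (intro dfn_ex dfn_conj dfn_all_less dfn_iff_const dfn_reindexing[OF \<chi>\<^sub>0] dfn2D[OF \<Psi>] dfn2D[OF dfn2_\<theta>]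
        shift reindexing_pre[OF shift(2)] reindexing_pre[OF list_reindexing_map] list_reindexing_map reindexing_row reindexing_id) simp_all
qed

lemma \<beta>\<^sub>0_tup: "\<beta>\<^sub>0 \<in> tup M (length \<beta>\<^sub>0)"
  using \<beta>\<^sub>0 B_U by (auto simp: tup_def)

text \<open>The conjunction of \<open>\<Delta> S\<close> over all patterns is one formula over
  \<open>\<beta>\<^sub>0\<close> and \<open>A\<close>, hence it does not compress.
  \<open>Y\<^sub>0\<close> does not depend on \<open>q\<close>, so the construction of a block can
  demand in advance that \<open>Y\<^sub>0\<close> be refuted.\<close>

lemma not_all_\<Delta>:
  obtains Y\<^sub>0 where "Y\<^sub>0 \<subseteq> Y" "finite Y\<^sub>0" "\<forall>q. range q \<subseteq> A \<longrightarrow> (\<forall>S \<subseteq> {..<k}. \<Delta> S \<beta>\<^sub>0 c q) \<longrightarrow>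
      (\<exists>y \<in> Y\<^sub>0. \<exists>x \<in> tup M l. (\<forall>S \<subseteq> {..<k}. \<Delta> S \<beta>\<^sub>0 x q) \<and> \<phi> x y)"
proof -
  define \<psi> where "\<psi> = (\<lambda>e. \<forall>S \<in> Pow {..<k}. \<Delta> S (map (\<lambda>i. e (i + l)) [0..<length \<beta>\<^sub>0]) (map e [0..<l])
      (\<lambda>i. e (i + length \<beta>\<^sub>0 + l)))"
  have "dfn \<psi>"
    unfolding \<psi>_def by (intro dfn_ball dfn_\<Delta> reindexing_rules) simp_all
  moreover have "\<psi> (pre x (pre \<beta>\<^sub>0 q)) \<longleftrightarrow> (\<forall>S \<subseteq> {..<k}. \<Delta> S \<beta>\<^sub>0 x q)" if "x \<in> tup M l" for x q
    using that by (simp add: \<psi>_def map_pre tup_length pre_shift_apply) blast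
  ultimately show thesis
    using noncompress_over[OF noncompress \<beta>\<^sub>0, of \<psi>] c that by auto
qed

section \<open>Relations definable over \<open>A\<close> and a finite tuple\<close>

definition definable_over :: "'a list \<Rightarrow> ('a list \<Rightarrow> bool) \<Rightarrow> bool" where
  "definable_over \<beta> E \<longleftrightarrow> (\<exists>E\<^sub>0 a. dfn E\<^sub>0 \<and> range a \<subseteq> A \<and> (\<forall>x \<in> tup M l. E x \<longleftrightarrow> E\<^sub>0 (pre x (pre \<beta> a))))"

lemma definable_over_I:
  "dfn E\<^sub>0 \<Longrightarrow> range a \<subseteq> A \<Longrightarrow> (\<And>x. x \<in> tup M l \<Longrightarrow> E x \<longleftrightarrow> E\<^sub>0 (pre x (pre \<beta> a))) \<Longrightarrow> definable_over \<beta> E"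
  unfolding definable_over_def by blast

lemma definable_over_True: "definable_over \<beta> (\<lambda>x. True)"
  by (rule definable_over_I[OF dfn_True, of "\<lambda>_. a\<^sub>0"]) (auto simp: a\<^sub>0)

lemma definable_over_conj:
  assumes "definable_over \<beta> E" "definable_over \<beta> F" shows "definable_over \<beta> (\<lambda>x. E x \<and> F x)"
proof -
  obtain E\<^sub>0 a where E: "dfn E\<^sub>0" "range a \<subseteq> A" "\<And>x. x \<in> tup M l \<Longrightarrow> E x \<longleftrightarrow> E\<^sub>0 (pre x (pre \<beta> a))"
    using assms(1) unfolding definable_over_def by blast
  obtain F\<^sub>0 a' where F: "dfn F\<^sub>0" "range a' \<subseteq> A" "\<And>x. x \<in> tup M l \<Longrightarrow> F x \<longleftrightarrow> F\<^sub>0 (pre x (pre \<beta> a'))"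
    using assms(2) unfolding definable_over_def by blast
  let ?p = "\<lambda>j e. pre (map e [0..<l]) (pre (map (\<lambda>i. e (i + l)) [0..<length \<beta>]) (row j (\<lambda>i. e (i + length \<beta> + l))))"
  show ?thesis
  proof (rule definable_over_I)
    show "dfn (\<lambda>e. E\<^sub>0 (?p 0 e) \<and> F\<^sub>0 (?p 1 e))"
      by (intro dfn_conj dfn_reindexing[OF E(1)] dfn_reindexing[OF F(1)] reindexing_rules) simp_all
    show "range (mix (case_nat a (\<lambda>_. a'))) \<subseteq> A"
      using E F by (intro range_mix) (auto split: nat.splits)
  qed (simp add: E F map_pre tup_length pre_shift_apply)
qed

lemma definable_over_ball: "finite S \<Longrightarrow> (\<And>s. s \<in> S \<Longrightarrow> definable_over \<beta> (E s)) \<Longrightarrow> definable_over \<beta> (\<lambda>x. \<forall>s \<in> S. E s x)"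
  by (induction S rule: finite_induct) (auto simp: definable_over_True intro!: definable_over_conj)

text \<open>The premise does not involve \<open>x\<close>, so its truth value is settled before a
  formula is chosen.\<close>

lemma definable_over_imp: "(P \<Longrightarrow> definable_over \<beta> E) \<Longrightarrow> definable_over \<beta> (\<lambda>x. P \<longrightarrow> E x)"
  by (cases P) (auto simp: definable_over_True)

lemma definable_over_append:
  assumes "definable_over \<beta> E" shows "definable_over (\<beta> @ b) E"
proof -
  obtain E\<^sub>0 a where E: "dfn E\<^sub>0" "range a \<subseteq> A" "\<And>x. x \<in> tup M l \<Longrightarrow> E x \<longleftrightarrow> E\<^sub>0 (pre x (pre \<beta> a))"
    using assms unfolding definable_over_def by blast
  show ?thesis
  proof (rule definable_over_I)
    show "dfn (\<lambda>e. E\<^sub>0 (pre (map e [0..<l]) (pre (map (\<lambda>i. e (i + l)) [0..<length \<beta>])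
        (\<lambda>i. e (i + length b + length \<beta> + l)))))"
      by (intro dfn_reindexing[OF E(1)] reindexing_rules) simp_all
  qed (use E in \<open>simp_all add: pre_append map_pre tup_length pre_shift_apply\<close>)
qed

lemma definable_over_\<Psi>:
  assumes "length b = m" shows "definable_over (\<beta> @ b) (\<lambda>x. \<Psi> x b)"
proof (rule definable_over_I)
  show "dfn (\<lambda>e. \<Psi> (map e [0..<l]) (map (\<lambda>i. e (i + length \<beta> + l)) [0..<m]))"
    by (intro dfn2D[OF \<Psi>] reindexing_rules) simp_all
  show "range (\<lambda>_. a\<^sub>0) \<subseteq> A" using a\<^sub>0 by auto
qed (use assms in \<open>simp add: pre_append map_pre tup_length pre_shift_apply\<close>)

lemma definable_over_not_\<Delta>:
  assumes "range q \<subseteq> A" shows "definable_over (\<beta>\<^sub>0 @ \<beta>) (\<lambda>x. \<not> \<Delta> S \<beta>\<^sub>0 x q)"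
proof (rule definable_over_I)
  show "dfn (\<lambda>e. \<not> \<Delta> S (map (\<lambda>i. e (i + l)) [0..<length \<beta>\<^sub>0]) (map e [0..<l])
      (\<lambda>i. e (i + length \<beta> + length \<beta>\<^sub>0 + l)))"
    by (intro dfn_not dfn_\<Delta> reindexing_rules) simp_all
qed (use assms in \<open>simp_all add: pre_append map_pre tup_length pre_shift_apply\<close>)

text \<open>Induction on \<open>N\<close> for all \<open>\<beta>\<close> and \<open>E\<close> at
  once. The hypothesis is applied to a smaller relation \<open>E'\<close>, which keeps
  \<open>\<Delta>\<close> false at \<open>x\<close> on the new block wherever it is false at
  \<open>c\<close>. To make it true, \<open>x\<close> is taken in \<open>E\<close> with
  \<open>\<Psi>(x,z)\<close> for a \<open>z\<close> of the right pattern; the formula being broken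
  records that such \<open>x\<close> still shatter the old blocks.\<close>

lemma blocks:
  assumes "set \<beta> \<subseteq> B" "definable_over (\<beta>\<^sub>0 @ \<beta>) E" "E c"
  shows "\<exists>Ss q. length Ss = N \<and> set Ss \<subseteq> Pow {..<k} \<and> (\<forall>j<N. range (q j) \<subseteq> A) \<and>
    (\<forall>R \<subseteq> {..<N}. \<exists>x \<in> tup M l. E x \<and> (\<forall>j<N. \<Delta> (Ss ! j) \<beta>\<^sub>0 x (q j) \<longleftrightarrow> j \<in> R))"
  using assms
proof (induction N arbitrary: \<beta> E)
  case 0
  have "range (\<lambda>_. a\<^sub>0) \<subseteq> A" using a\<^sub>0 by auto
  then show ?case using c 0 by (intro exI[of _ "[]"] exI[of _ "\<lambda>_ _. a\<^sub>0"]) auto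
next
  case (Suc N)
  define s where "s = length \<beta>\<^sub>0"
  define r where "r = length \<beta>"
  obtain E\<^sub>0 a\<^sub>E where E\<^sub>0: "dfn E\<^sub>0" and a\<^sub>E: "range a\<^sub>E \<subseteq> A"
      and E: "\<And>x. x \<in> tup M l \<Longrightarrow> E x \<longleftrightarrow> E\<^sub>0 (pre x (pre (\<beta>\<^sub>0 @ \<beta>) a\<^sub>E))"
    using Suc.prems(2) unfolding definable_over_def by (elim exE conjE) (rule that, auto)
  obtain Y\<^sub>0 where Y\<^sub>0: "Y\<^sub>0 \<subseteq> Y" "finite Y\<^sub>0" and not_all: "\<forall>q. range q \<subseteq> A \<longrightarrow> (\<forall>S \<subseteq> {..<k}. \<Delta> S \<beta>\<^sub>0 c q) \<longrightarrow>
      (\<exists>y \<in> Y\<^sub>0. \<exists>x \<in> tup M l. (\<forall>S \<subseteq> {..<k}. \<Delta> S \<beta>\<^sub>0 x q) \<and> \<phi> x y)"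
    by (rule not_all_\<Delta>) (rule that)
  obtain yl where yl: "set yl = Y\<^sub>0" using finite_list[OF Y\<^sub>0(2)] by auto
  define t where "t = length yl"
  \<comment> \<open>The rows of the parameter sequence hold the parameters of \<open>\<chi>\<^sub>0\<close>, those of \<open>E\<close>,
    the elements of \<open>Y\<^sub>0\<close>, and the blocks of the induction hypothesis.\<close>
  define \<chi> where "\<chi> = (\<lambda>Ss e. \<chi>\<^sub>0 (pre (map e [0..<m]) (pre (map (\<lambda>i. e (i + m)) [0..<s]) (row 0 (\<lambda>i. e (i + r + s + m))))) \<and>
    (\<forall>i<t. \<not> \<theta> (map e [0..<m]) (map (row (2 + i) (\<lambda>i. e (i + r + s + m))) [0..<n])) \<and>
    (\<forall>R \<in> Pow {..<N}. \<exists>x \<in> tup M l.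
       E\<^sub>0 (pre x (pre (map (\<lambda>i. e (i + m)) [0..<s]) (pre (map (\<lambda>i. e (i + s + m)) [0..<r]) (row 1 (\<lambda>i. e (i + r + s + m)))))) \<and>
       \<Psi> x (map e [0..<m]) \<and>
       (\<forall>j<N. \<Delta> (Ss ! j) (map (\<lambda>i. e (i + m)) [0..<s]) x (row (2 + t + j) (\<lambda>i. e (i + r + s + m))) \<longleftrightarrow> j \<in> R)))"
  have dfn_\<chi>: "dfn (\<chi> Ss)" for Ss
    unfolding \<chi>_def
    by (intro dfn_conj dfn_not dfn_all_less dfn_ball dfn_ex dfn_iff_const dfn_reindexing[OF \<chi>\<^sub>0] dfn_reindexing[OF E\<^sub>0]
        dfn2D[OF \<Psi>] dfn2D[OF dfn2_\<theta>] dfn_\<Delta> reindexing_rules) (simp_all add: s_def)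
  have \<chi>_iff: "\<chi> Ss (pre z (pre (\<beta>\<^sub>0 @ \<beta>) p)) \<longleftrightarrow> \<chi>\<^sub>0 (pre z (pre \<beta>\<^sub>0 (row 0 p))) \<and>
      (\<forall>i<t. \<not> \<theta> z (map (row (2 + i) p) [0..<n])) \<and>
      (\<forall>R \<subseteq> {..<N}. \<exists>x \<in> tup M l. E\<^sub>0 (pre x (pre (\<beta>\<^sub>0 @ \<beta>) (row 1 p))) \<and> \<Psi> x z \<and>
        (\<forall>j<N. \<Delta> (Ss ! j) \<beta>\<^sub>0 x (row (2 + t + j) p) \<longleftrightarrow> j \<in> R))"
    if "z \<in> tup M m" for Ss z p
    using that by (simp add: \<chi>_def s_def r_def pre_append map_pre tup_length pre_shift_apply Pow_def Ball_def)
  \<comment> \<open>The patterns \<open>Ss\<close> are known only after the induction hypothesis is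
    used, but there are finitely many candidates; the breaking sets for all of them go into
    \<open>Z\<close> before \<open>b\<close> is chosen.\<close>
  define SS where "SS = {Ss. set Ss \<subseteq> Pow {..<k} \<and> length Ss = N}"
  have SS: "finite SS" unfolding SS_def by (rule finite_lists_length_eq) simp
  have set_\<beta>: "set (\<beta>\<^sub>0 @ \<beta>) \<subseteq> B" using \<beta>\<^sub>0 Suc.prems(1) by simp
  define V where "V = (\<lambda>Ss Z. Z \<subseteq> Y \<and> finite Z \<and> (\<forall>b \<in> tup B m. good Z b \<longrightarrow> (\<forall>p. range p \<subseteq> A \<longrightarrow>
      \<chi> Ss (pre b (pre (\<beta>\<^sub>0 @ \<beta>) p)) \<longrightarrow>
      (\<exists>ys. (\<forall>j<k. ys j \<in> Z) \<and> shattered (\<lambda>z. \<chi> Ss (pre z (pre (\<beta>\<^sub>0 @ \<beta>) p))) k ys))))"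
  have "\<forall>Ss. \<exists>Z. V Ss Z"
    unfolding V_def by (rule allI, rule breakableE[OF breakable_k[OF set_\<beta>] dfn_\<chi>]) (intro exI conjI)
  then obtain Zf where V: "\<And>Ss. V Ss (Zf Ss)" by metis
  have Zf: "Zf Ss \<subseteq> Y" "finite (Zf Ss)" for Ss
    using V[of Ss] unfolding V_def by simp_all
  note Zf_shattered = V[unfolded V_def, THEN conjunct2, THEN conjunct2]
  define Z where "Z = Y\<^sub>0 \<union> (\<Union>Ss \<in> SS. Zf Ss)"
  have Z: "Z \<subseteq> Y" "finite Z" using Y\<^sub>0 Zf SS by (auto simp: Z_def)
  \<comment> \<open>\<open>b\<close> is good for all of \<open>Z\<close> and at the same time
    witnesses that depth \<open>Suc k\<close> fails over \<open>\<beta>\<^sub>0\<close>.\<close>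
  obtain b a where b: "b \<in> tup B m" "good Z b" and a: "range a \<subseteq> A" "\<chi>\<^sub>0 (pre b (pre \<beta>\<^sub>0 a))"
    and not_sh: "\<forall>ys. (\<forall>j<Suc k. ys j \<in> Z) \<longrightarrow> \<not> shattered (\<lambda>z. \<chi>\<^sub>0 (pre z (pre \<beta>\<^sub>0 a))) (Suc k) ys"
    using not_breakable_Suc_k[OF Z] by (elim exE conjE) (rule that)
  have b_tup: "b \<in> tup M m" using tup_mono[OF B_U b(1)] .
  have Z_tup: "y \<in> tup A n" if "y \<in> Z" for y using that Z(1) by (auto simp: Y_def)
  \<comment> \<open>All blocks that can be built from \<open>a\<close> and \<open>Z\<close> are
    considered, since the relevant \<open>ys\<close> is found only after the induction hypothesis is
    used.\<close>
  define E' where "E' = (\<lambda>x. (E x \<and> \<Psi> x b) \<and> (\<forall>S \<in> Pow {..<k}. \<forall>ys \<in> ({..<k} \<rightarrow>\<^sub>E Z).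
      \<not> \<Delta> S \<beta>\<^sub>0 c (block a ys) \<longrightarrow> \<not> \<Delta> S \<beta>\<^sub>0 x (block a ys)))"
  have "definable_over (\<beta>\<^sub>0 @ (\<beta> @ b)) E'"
    unfolding E'_def
  proof (intro definable_over_conj definable_over_ball definable_over_imp)
    show "definable_over (\<beta>\<^sub>0 @ (\<beta> @ b)) E" using definable_over_append[OF Suc.prems(2), of b] by simp
    show "definable_over (\<beta>\<^sub>0 @ (\<beta> @ b)) (\<lambda>x. \<Psi> x b)"
      using definable_over_\<Psi>[of b "\<beta>\<^sub>0 @ \<beta>"] b(1) by (simp add: tup_length)
    show "finite ({..<k} \<rightarrow>\<^sub>E Z)" using Z(2) by (intro finite_PiE) auto
    fix S ys assume "ys \<in> {..<k} \<rightarrow>\<^sub>E Z"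
    then show "definable_over (\<beta>\<^sub>0 @ (\<beta> @ b)) (\<lambda>x. \<not> \<Delta> S \<beta>\<^sub>0 x (block a ys))"
      by (intro definable_over_not_\<Delta> range_block a Z_tup) auto
  qed simp
  moreover have "set (\<beta> @ b) \<subseteq> B" using Suc.prems(1) b(1) by (auto dest: tup_subset)
  moreover have "E' c" using Suc.prems(3) b(2) by (auto simp: E'_def good_def)
  ultimately obtain Ss q where Ss: "length Ss = N" "set Ss \<subseteq> Pow {..<k}" and q: "\<forall>j<N. range (q j) \<subseteq> A"
    and IH: "\<forall>R \<subseteq> {..<N}. \<exists>x \<in> tup M l. E' x \<and> (\<forall>j<N. \<Delta> (Ss ! j) \<beta>\<^sub>0 x (q j) \<longleftrightarrow> j \<in> R)"
    using Suc.IH[of "\<beta> @ b" E'] by (elim exE conjE meta_impE) (auto simp del: append_assoc)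
  define p where "p = mix (\<lambda>i. if i = 0 then a else if i = 1 then a\<^sub>E
      else if i < 2 + t then pre (yl ! (i - 2)) (\<lambda>_. a\<^sub>0) else if i < 2 + t + N then q (i - 2 - t) else (\<lambda>_. a\<^sub>0))"
  have yl_tup: "yl ! i \<in> tup A n" if "i < t" for i
    using that yl Y\<^sub>0(1) by (auto simp: t_def Y_def)
  have p: "range p \<subseteq> A"
    unfolding p_def
  proof (rule range_mix)
    fix i
    have "range (pre (yl ! (i - 2)) (\<lambda>_. a\<^sub>0)) \<subseteq> A" if "i < 2 + t" "i \<noteq> 0" "i \<noteq> 1"
    proof -
      have "i - 2 < t" using that by linarith
      then show ?thesis using tup_subset[OF yl_tup] a\<^sub>0 by (intro range_pre) auto
    qed
    then show "range (if i = 0 then a else if i = 1 then a\<^sub>E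
      else if i < 2 + t then pre (yl ! (i - 2)) (\<lambda>_. a\<^sub>0) else if i < 2 + t + N then q (i - 2 - t) else (\<lambda>_. a\<^sub>0)) \<subseteq> A"
      using a(1) a\<^sub>E q a\<^sub>0 by auto
  qed
  have rows: "row 0 p = a" "row 1 p = a\<^sub>E" "\<And>j. j < N \<Longrightarrow> row (2 + t + j) p = q j"
      "\<And>i. i < t \<Longrightarrow> map (row (2 + i) p) [0..<n] = yl ! i"
    using map_pre[OF tup_length[OF yl_tup]] by (simp_all add: p_def)
  have \<chi>_iff': "\<chi> Ss (pre z (pre (\<beta>\<^sub>0 @ \<beta>) p)) \<longleftrightarrow> \<chi>\<^sub>0 (pre z (pre \<beta>\<^sub>0 a)) \<and> (\<forall>y \<in> Y\<^sub>0. \<not> \<theta> z y) \<and>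
      (\<forall>R \<subseteq> {..<N}. \<exists>x \<in> tup M l. E x \<and> \<Psi> x z \<and> (\<forall>j<N. \<Delta> (Ss ! j) \<beta>\<^sub>0 x (q j) \<longleftrightarrow> j \<in> R))"
    if "z \<in> tup M m" for z
  proof -
    have "(\<forall>i<t. \<not> \<theta> z (map (row (2 + i) p) [0..<n])) \<longleftrightarrow> (\<forall>y \<in> Y\<^sub>0. \<not> \<theta> z y)"
      using rows(4) unfolding yl[symmetric] t_def by (auto simp: all_set_conv_all_nth)
    then show ?thesis
      using \<chi>_iff[OF that, of Ss p] rows(1,2,3) E by simp
  qed
  \<comment> \<open>The \<open>x\<close> provided in \<open>E'\<close> satisfy
    \<open>\<Psi>(x,b)\<close>, and \<open>b\<close> is good for \<open>Y\<^sub>0\<close>, a part of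
    \<open>Z\<close>.\<close>
  have "\<chi> Ss (pre b (pre (\<beta>\<^sub>0 @ \<beta>) p))"
    unfolding \<chi>_iff'[OF b_tup]
    using a(2) b(2) IH by (auto simp: good_def Z_def E'_def)
  moreover have "Ss \<in> SS" using Ss by (simp add: SS_def)
  then have "good (Zf Ss) b" using b(2) by (auto simp: good_def Z_def)
  ultimately obtain ys where ys: "\<forall>j<k. ys j \<in> Zf Ss"
    and sh: "shattered (\<lambda>z. \<chi> Ss (pre z (pre (\<beta>\<^sub>0 @ \<beta>) p))) k ys"
    using Zf_shattered[rule_format, OF b(1) _ p] by blast
  have ys_Z: "ys j \<in> Z" if "j < k" for j using that ys \<open>Ss \<in> SS\<close> by (auto simp: Z_def)
  have ys_tup: "ys j \<in> tup A n" if "j < k" for j using Z_tup[OF ys_Z[OF that]] .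
  have \<Delta>_ys: "\<Delta> S b' x (block a ys) \<longleftrightarrow> (\<exists>z \<in> tup M m. \<Psi> x z \<and> \<chi>\<^sub>0 (pre z (pre b' a)) \<and>
      (\<forall>j<k. \<theta> z (ys j) \<longleftrightarrow> j \<in> S))" for S b' x
    by (rule \<Delta>_block) (rule ys_tup)
  have block_A: "range (block a ys) \<subseteq> A" by (rule range_block[OF a(1) ys_tup])
  \<comment> \<open>If every pattern were compatible with \<open>\<theta> z y\<close>, then
    \<open>ys\<close> with \<open>y\<close> added would be shattered at depth \<open>Suc k\<close>:
    the patterns with \<open>\<theta> z y\<close> false come from \<open>\<chi>\<close>, which
    excludes \<open>\<theta>\<close> on \<open>Y\<^sub>0\<close>.\<close>
  have kill: "\<exists>S \<subseteq> {..<k}. \<forall>z \<in> tup M m. \<chi>\<^sub>0 (pre z (pre \<beta>\<^sub>0 a)) \<longrightarrow> (\<forall>j<k. \<theta> z (ys j) \<longleftrightarrow> j \<in> S) \<longrightarrow> \<not> \<theta> z y"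
    if y: "y \<in> Y\<^sub>0" for y
  proof (rule ccontr)
    assume contra: "\<not> ?thesis"
    have "shattered (\<lambda>z. \<chi>\<^sub>0 (pre z (pre \<beta>\<^sub>0 a))) (Suc k) (ys(k := y))"
      unfolding shattered_def
    proof (intro allI impI)
      fix S assume S: "S \<subseteq> {..<Suc k}"
      show "\<exists>z\<in>tup M m. \<chi>\<^sub>0 (pre z (pre \<beta>\<^sub>0 a)) \<and> (\<forall>j<Suc k. \<theta> z ((ys(k := y)) j) \<longleftrightarrow> j \<in> S)"
      proof (cases "k \<in> S")
        case True
        have "S - {k} \<subseteq> {..<k}" using S by auto
        with contra obtain z where "z \<in> tup M m" "\<chi>\<^sub>0 (pre z (pre \<beta>\<^sub>0 a))"
            "\<forall>j<k. \<theta> z (ys j) \<longleftrightarrow> j \<in> S - {k}" "\<theta> z y" by blast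
        then show ?thesis using True by (intro bexI[of _ z]) (auto simp: less_Suc_eq)
      next
        case False
        then have "S \<subseteq> {..<k}" using S by (auto simp: less_Suc_eq)
        with sh obtain z where z: "z \<in> tup M m" "\<chi> Ss (pre z (pre (\<beta>\<^sub>0 @ \<beta>) p))"
            "\<forall>j<k. \<theta> z (ys j) \<longleftrightarrow> j \<in> S" unfolding shattered_def by blast
        then show ?thesis using False y \<chi>_iff'[OF z(1)] by (intro bexI[of _ z]) (auto simp: less_Suc_eq)
      qed
    qed
    moreover have "\<forall>j<Suc k. (ys(k := y)) j \<in> Z"
      using ys_Z y by (auto simp: less_Suc_eq Z_def)
    ultimately show False using not_sh by blast
  qed
  \<comment> \<open>Otherwise some \<open>x\<close> satisfies \<open>\<Delta> S\<close> for all
    patterns and \<open>\<phi>(x,y)\<close> for some \<open>y\<close> in \<open>Y\<^sub>0\<close>.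
    For the pattern excluding \<open>\<theta> z y\<close>, the tuple \<open>z\<close> given by
    \<open>\<Delta>\<close> satisfies \<open>\<Psi>(x,z)\<close>, and \<open>x\<close> itself then
    witnesses \<open>\<theta> z y\<close>.\<close>
  have "\<exists>S \<subseteq> {..<k}. \<not> \<Delta> S \<beta>\<^sub>0 c (block a ys)"
  proof (rule ccontr)
    assume "\<not> ?thesis"
    then have all: "\<forall>S \<subseteq> {..<k}. \<Delta> S \<beta>\<^sub>0 c (block a ys)" by blast
    from not_all[THEN spec, THEN mp, OF block_A, THEN mp, OF all]
    obtain y x where y: "y \<in> Y\<^sub>0" "x \<in> tup M l" "\<forall>S \<subseteq> {..<k}. \<Delta> S \<beta>\<^sub>0 x (block a ys)" "\<phi> x y"
      by (elim bexE conjE) (rule that)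
    from kill[OF y(1)] obtain S where S: "S \<subseteq> {..<k}"
      "\<forall>z \<in> tup M m. \<chi>\<^sub>0 (pre z (pre \<beta>\<^sub>0 a)) \<longrightarrow> (\<forall>j<k. \<theta> z (ys j) \<longleftrightarrow> j \<in> S) \<longrightarrow> \<not> \<theta> z y"
      by (elim exE conjE) (rule that)
    obtain z where z: "z \<in> tup M m" "\<Psi> x z" "\<chi>\<^sub>0 (pre z (pre \<beta>\<^sub>0 a))" "\<forall>j<k. \<theta> z (ys j) \<longleftrightarrow> j \<in> S"
      using y(3)[rule_format, OF S(1)] unfolding \<Delta>_ys by (elim bexE conjE) (rule that)
    have "\<theta> z y" using y(2,4) z(2) unfolding \<theta>_def by blast
    then show False using S(2) z by blast
  qed
  then obtain S where S: "S \<subseteq> {..<k}" "\<not> \<Delta> S \<beta>\<^sub>0 c (block a ys)" by blast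
  show ?case
  proof (intro exI conjI allI impI)
    show "length (S # Ss) = Suc N" "set (S # Ss) \<subseteq> Pow {..<k}" using S Ss by auto
    show "range (case_nat (block a ys) q j) \<subseteq> A" if "j < Suc N" for j
      using that q block_A by (cases j) auto
    fix R assume R: "R \<subseteq> {..<Suc N}"
    \<comment> \<open>The new block comes first, so the old indices move up by one.\<close>
    define R' where "R' = {j. Suc j \<in> R}"
    have R': "R' \<subseteq> {..<N}" using R by (auto simp: R'_def)
    have "\<exists>x \<in> tup M l. E x \<and> (\<forall>j<N. \<Delta> (Ss ! j) \<beta>\<^sub>0 x (q j) \<longleftrightarrow> j \<in> R') \<and> (\<Delta> S \<beta>\<^sub>0 x (block a ys) \<longleftrightarrow> 0 \<in> R)"
    proof (cases "0 \<in> R")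
      case True
      \<comment> \<open>As \<open>z\<close> satisfies \<open>\<chi>\<close>, the pattern
        \<open>R'\<close> on the old blocks is realised by some \<open>x\<close> with
        \<open>\<Psi>(x,z)\<close>; then \<open>z\<close> witnesses \<open>\<Delta> S\<close> at
        this \<open>x\<close>.\<close>
      obtain z where z: "z \<in> tup M m" "\<chi> Ss (pre z (pre (\<beta>\<^sub>0 @ \<beta>) p))" "\<forall>j<k. \<theta> z (ys j) \<longleftrightarrow> j \<in> S"
        using sh S(1) unfolding shattered_def by blast
      then have \<chi>\<^sub>0z: "\<chi>\<^sub>0 (pre z (pre \<beta>\<^sub>0 a))" and "\<exists>x \<in> tup M l. E x \<and> \<Psi> x z \<and> (\<forall>j<N. \<Delta> (Ss ! j) \<beta>\<^sub>0 x (q j) \<longleftrightarrow> j \<in> R')"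
        using \<chi>_iff'[OF z(1)] R' by auto
      then obtain x where x: "x \<in> tup M l" "E x" "\<Psi> x z" "\<forall>j<N. \<Delta> (Ss ! j) \<beta>\<^sub>0 x (q j) \<longleftrightarrow> j \<in> R'" by blast
      have "\<Delta> S \<beta>\<^sub>0 x (block a ys)" unfolding \<Delta>_ys using z x(3) \<chi>\<^sub>0z by blast
      then show ?thesis using x True by blast
    next
      case False
      obtain x where x: "x \<in> tup M l" "E' x" "\<forall>j<N. \<Delta> (Ss ! j) \<beta>\<^sub>0 x (q j) \<longleftrightarrow> j \<in> R'"
        using IH R' by blast
      \<comment> \<open>\<open>E'\<close> quantifies over restricted functions, and a block ignores
        the values from \<open>k\<close> on.\<close>
      have "block a (restrict ys {..<k}) = block a ys"
        unfolding block_def by (intro arg_cong[of _ _ mix] ext) (auto split: nat.splits)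
      moreover have "restrict ys {..<k} \<in> {..<k} \<rightarrow>\<^sub>E Z" using ys_Z by auto
      ultimately have "\<not> \<Delta> S \<beta>\<^sub>0 x (block a ys)"
        using x(2) S unfolding E'_def by (metis PowI)
      then show ?thesis using x False by (auto simp: E'_def)
    qed
    then obtain x where "x \<in> tup M l" "E x" "\<forall>j<N. \<Delta> (Ss ! j) \<beta>\<^sub>0 x (q j) \<longleftrightarrow> j \<in> R'"
        "\<Delta> S \<beta>\<^sub>0 x (block a ys) \<longleftrightarrow> 0 \<in> R" by blast
    then show "\<exists>x \<in> tup M l. E x \<and> (\<forall>j<Suc N. \<Delta> ((S # Ss) ! j) \<beta>\<^sub>0 x (case_nat (block a ys) q j) \<longleftrightarrow> j \<in> R)"
      by (intro bexI[of _ x]) (auto simp: R'_def less_Suc_eq_0_disj)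
  qed
qed

text \<open>For each pattern \<open>S\<close>, NIP bounds how many blocks \<open>\<Delta> S\<close>
  can shatter. \<open>N\<close> exceeds the sum of these bounds over the finitely many
  patterns.\<close>

lemma critical_depth_impossible: False
proof -
  define s where "s = length \<beta>\<^sub>0"
  define P where "P = (\<lambda>S e. \<Delta> S (map (\<lambda>i. e (i + l)) [0..<s]) (map e [0..<l]) (\<lambda>i. e (i + s + l)))"
  have P: "P S (pre x (pre \<beta>\<^sub>0 q)) \<longleftrightarrow> \<Delta> S \<beta>\<^sub>0 x q" if "x \<in> tup M l" for S x q
    using that by (simp add: P_def s_def map_pre tup_length pre_shift_apply)
  have dfn_P: "dfn (P S)" for S
    unfolding P_def by (intro dfn_\<Delta> reindexing_rules) (simp_all add: s_def)
  have "\<forall>S. \<exists>d. \<forall>(N::nat) vs. (\<forall>j<N. range (vs j) \<subseteq> M) \<longrightarrow>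
      (\<forall>R \<subseteq> {..<N}. \<exists>x \<in> tup M l. \<forall>j<N. P S (pre x (vs j)) \<longleftrightarrow> j \<in> R) \<longrightarrow> N \<le> d"
    by (rule allI, rule nip[OF dfn_P])
  then obtain d where d: "\<forall>S (N::nat) vs. (\<forall>j<N. range (vs j) \<subseteq> M) \<longrightarrow>
      (\<forall>R \<subseteq> {..<N}. \<exists>x \<in> tup M l. \<forall>j<N. P S (pre x (vs j)) \<longleftrightarrow> j \<in> R) \<longrightarrow> N \<le> d S"
    by (elim choice[THEN exE]) (rule that)
  define N where "N = Suc (\<Sum>S \<in> Pow {..<k}. d S)"
  obtain Ss q where Ss: "length Ss = N" "set Ss \<subseteq> Pow {..<k}" and q: "\<forall>j<N. range (q j) \<subseteq> A"
    and shatter: "\<forall>R \<subseteq> {..<N}. \<exists>x \<in> tup M l. True \<and> (\<forall>j<N. \<Delta> (Ss ! j) \<beta>\<^sub>0 x (q j) \<longleftrightarrow> j \<in> R)"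
    using blocks[of "[]" "\<lambda>_. True" N] definable_over_True by (elim exE conjE meta_impE) auto
  define J where "J = (\<lambda>S. {j \<in> {..<N}. Ss ! j = S})"
  have J: "card (J S) \<le> d S" for S
  proof -
    \<comment> \<open>\<open>h\<close> lists the blocks of pattern \<open>S\<close>; restricting the
      shattering to them leaves a single formula.\<close>
    obtain h where h: "bij_betw h {0..<card (J S)} (J S)"
      using ex_bij_betw_nat_finite[of "J S"] by (auto simp: J_def)
    have hJ: "h i < N" "Ss ! h i = S" if "i < card (J S)" for i
      using bij_betwE[OF h] that by (auto simp: J_def)
    show ?thesis
    proof (rule d[THEN spec, THEN spec, THEN spec[of _ "\<lambda>i. pre \<beta>\<^sub>0 (q (h i))"], THEN mp, THEN mp])
      show "\<forall>i<card (J S). range (pre \<beta>\<^sub>0 (q (h i))) \<subseteq> M"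
        using q hJ(1) A_U \<beta>\<^sub>0_tup by (intro allI impI range_pre) (auto dest: tup_subset)
      show "\<forall>R\<subseteq>{..<card (J S)}. \<exists>x\<in>tup M l. \<forall>i<card (J S). P S (pre x (pre \<beta>\<^sub>0 (q (h i)))) \<longleftrightarrow> i \<in> R"
      proof (intro allI impI)
        fix R assume R: "R \<subseteq> {..<card (J S)}"
        have "h ` R \<subseteq> {..<N}" using hJ(1) R by auto
        from shatter[THEN spec, THEN mp, OF this]
        obtain x where x: "x \<in> tup M l" "\<forall>j<N. \<Delta> (Ss ! j) \<beta>\<^sub>0 x (q j) \<longleftrightarrow> j \<in> h ` R"
          by (elim bexE conjE) (rule that)
        have "P S (pre x (pre \<beta>\<^sub>0 (q (h i)))) \<longleftrightarrow> i \<in> R" if i: "i < card (J S)" for i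
        proof -
          have "P S (pre x (pre \<beta>\<^sub>0 (q (h i)))) \<longleftrightarrow> h i \<in> h ` R"
            using x(2) hJ[OF i] P[OF x(1)] by auto
          also have "\<dots> \<longleftrightarrow> i \<in> R"
            using bij_betw_imp_inj_on[OF h] R i by (intro inj_on_image_mem_iff[of h "{0..<card (J S)}"]) auto
          finally show ?thesis .
        qed
        then show "\<exists>x\<in>tup M l. \<forall>i<card (J S). P S (pre x (pre \<beta>\<^sub>0 (q (h i)))) \<longleftrightarrow> i \<in> R"
          using x(1) by blast
      qed
    qed
  qed
  have "Ss ! j \<in> Pow {..<k}" if "j < N" for j
    using subsetD[OF Ss(2) nth_mem] that Ss(1) by simp
  then have "{..<N} = (\<Union>S \<in> Pow {..<k}. J S)"
    by (auto simp: J_def)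
  then have "N = card (\<Union>S \<in> Pow {..<k}. J S)" by (metis card_lessThan)
  also have "\<dots> \<le> (\<Sum>S \<in> Pow {..<k}. card (J S))" by (rule card_UN_le) simp
  also have "\<dots> \<le> (\<Sum>S \<in> Pow {..<k}. d S)" by (rule sum_mono) (rule J)
  finally show False by (simp add: N_def)
qed

end

section \<open>Passage to the critical depth\<close>

context compression begin

lemma one_sided_compression:
  "\<exists>\<psi>. dfn \<psi> \<and> (\<forall>A\<^sub>0. finite A\<^sub>0 \<longrightarrow> A\<^sub>0 \<subseteq> A \<longrightarrow> (\<exists>a. range a \<subseteq> A \<and> \<psi> (pre c a) \<and>
     (\<forall>x \<in> tup M l. \<psi> (pre x a) \<longrightarrow> (\<forall>y \<in> tup A\<^sub>0 n. \<not> \<phi> c y \<longrightarrow> \<not> \<phi> x y))))"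
proof (rule ccontr)
  assume contra: "\<not> ?thesis"
  have noncompress: "\<exists>A\<^sub>0. finite A\<^sub>0 \<and> A\<^sub>0 \<subseteq> A \<and> (\<forall>a. range a \<subseteq> A \<longrightarrow> \<psi> (pre c a) \<longrightarrow>
      (\<exists>y \<in> tup A\<^sub>0 n. \<not> \<phi> c y \<and> (\<exists>x \<in> tup M l. \<psi> (pre x a) \<and> \<phi> x y)))" if "dfn \<psi>" for \<psi>
    using contra that by meson
  \<comment> \<open>\<open>Q k\<close> concerns depth \<open>Suc k\<close>, so for the least
    \<open>k\<close> depth \<open>k\<close> itself is breakable: by minimality if \<open>k\<close>
    is a successor, trivially if it is 0.\<close>
  define Q where "Q = (\<lambda>k. \<exists>\<beta>. set \<beta> \<subseteq> B \<and> \<not> breakable (Suc k) \<beta>)"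
  define k where "k = (LEAST k. Q k)"
  have "\<exists>k. Q k" using not_breakable_large unfolding Q_def by (metis empty_set empty_subsetI)
  then have "Q k" unfolding k_def by (rule LeastI_ex)
  then obtain \<beta>\<^sub>0 where \<beta>\<^sub>0: "set \<beta>\<^sub>0 \<subseteq> B" and not_breakable: "\<not> breakable (Suc k) \<beta>\<^sub>0" unfolding Q_def by blast
  have breakable_k: "breakable k \<beta>" if "set \<beta> \<subseteq> B" for \<beta>
  proof (cases k)
    case 0
    then show ?thesis by (simp add: breakable_0)
  next
    case (Suc k')
    then have "\<not> Q k'" unfolding k_def by (metis lessI not_less_Least)
    then show ?thesis using that Suc unfolding Q_def by blast
  qed
  show False
  proof (rule not_breakableE[OF not_breakable])
    fix \<chi> assume \<chi>: "dfn \<chi>" and fail: "\<And>Z. Z \<subseteq> Y \<Longrightarrow> finite Z \<Longrightarrow> \<exists>b a. b \<in> tup B m \<and> good Z b \<and> range a \<subseteq> A \<and>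
      \<chi> (pre b (pre \<beta>\<^sub>0 a)) \<and> (\<forall>ys. (\<forall>j<Suc k. ys j \<in> Z) \<longrightarrow> \<not> shattered (\<lambda>z. \<chi> (pre z (pre \<beta>\<^sub>0 a))) (Suc k) ys)"
    interpret critical_depth L U A B l n m c \<phi> \<Psi> k \<beta>\<^sub>0 \<chi>
      by unfold_locales (fact noncompress, fact \<beta>\<^sub>0, fact \<chi>, fact breakable_k, fact fail)
    show False by (rule critical_depth_impossible)
  qed
qed

end

section \<open>Compressible types and definable relations\<close>

lemma holds_at_inst: "holds_at U d (inst \<phi> a) \<longleftrightarrow> sat U (case_sum d a) \<phi>"
proof -
  have "case_sum d id \<circ> map_sum id a = case_sum d a" by (rule ext) (auto split: sum.splits)
  then show ?thesis by (simp add: holds_at_def inst_def sat_map)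
qed

lemma holds_at_Neg: "holds_at U d (Neg \<chi>) \<longleftrightarrow> \<not> holds_at U d \<chi>"
  by (simp add: holds_at_def sat_def)

lemma inst_formulas:
  assumes "\<phi> \<in> formulas L (I <+> {..<n})" "a \<in> {..<n} \<rightarrow> A"
  shows "inst \<phi> a \<in> formulas L (I <+> A)"
  using assms by (fastforce simp: formulas_def inst_def wf_fm_map fm.set_map)

lemma Neg_formulas: "Neg \<chi> \<in> formulas L V \<longleftrightarrow> \<chi> \<in> formulas L V"
  by (simp add: formulas_def)

text \<open>Membership in the type of a tuple is truth at \<open>b\<close>, so the implied positive
  and negative instances combine to agreement with \<open>b\<close> on
  \<open>\<phi>\<close>.\<close>

lemma compressible_tp_iff:
  "compressible L U I A (tp L U I b A) \<longleftrightarrow> (\<forall>n::nat. \<forall>\<phi> \<in> formulas L (I <+> {..<n}). \<exists>m::nat. \<exists>\<psi> \<in> formulas L (I <+> {..<m}).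
     \<forall>A\<^sub>0. finite A\<^sub>0 \<and> A\<^sub>0 \<subseteq> A \<longrightarrow> (\<exists>c \<in> {..<m} \<rightarrow>\<^sub>E A. sat U (case_sum b c) \<psi> \<and>
       (\<forall>d \<in> I \<rightarrow>\<^sub>E univ U. sat U (case_sum d c) \<psi> \<longrightarrow>
         (\<forall>a \<in> {..<n} \<rightarrow>\<^sub>E A\<^sub>0. sat U (case_sum d a) \<phi> \<longleftrightarrow> sat U (case_sum b a) \<phi>))))"
proof -
  have tp: "inst \<phi> a \<in> tp L U I b A \<longleftrightarrow> sat U (case_sum b a) \<phi>"
       "Neg (inst \<phi> a) \<in> tp L U I b A \<longleftrightarrow> \<not> sat U (case_sum b a) \<phi>"
    if "\<phi> \<in> formulas L (I <+> {..<n})" "a \<in> {..<n} \<rightarrow>\<^sub>E A" for \<phi> n a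
  proof -
    have "a \<in> {..<n} \<rightarrow> A" using that(2) by (simp add: PiE_def)
    then have "inst \<phi> a \<in> formulas L (I <+> A)" by (rule inst_formulas[OF that(1)])
    then show "inst \<phi> a \<in> tp L U I b A \<longleftrightarrow> sat U (case_sum b a) \<phi>"
        "Neg (inst \<phi> a) \<in> tp L U I b A \<longleftrightarrow> \<not> sat U (case_sum b a) \<phi>"
      by (simp_all add: tp_def holds_at_inst holds_at_Neg Neg_formulas)
  qed
  have implies: "implies U I (inst \<psi> c)
       ({inst \<phi> a | a. a \<in> {..<n} \<rightarrow>\<^sub>E A\<^sub>0 \<and> inst \<phi> a \<in> tp L U I b A} \<union>
        {Neg (inst \<phi> a) | a. a \<in> {..<n} \<rightarrow>\<^sub>E A\<^sub>0 \<and> Neg (inst \<phi> a) \<in> tp L U I b A}) \<longleftrightarrow>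
      (\<forall>d \<in> I \<rightarrow>\<^sub>E univ U. sat U (case_sum d c) \<psi> \<longrightarrow>
         (\<forall>a \<in> {..<n} \<rightarrow>\<^sub>E A\<^sub>0. sat U (case_sum d a) \<phi> \<longleftrightarrow> sat U (case_sum b a) \<phi>))"
    if \<phi>: "\<phi> \<in> formulas L (I <+> {..<n})" and A\<^sub>0: "A\<^sub>0 \<subseteq> A" for \<phi> n \<psi> c A\<^sub>0
  proof -
    have tp': "inst \<phi> a \<in> tp L U I b A \<longleftrightarrow> sat U (case_sum b a) \<phi>"
       "Neg (inst \<phi> a) \<in> tp L U I b A \<longleftrightarrow> \<not> sat U (case_sum b a) \<phi>"
      if "a \<in> {..<n} \<rightarrow>\<^sub>E A\<^sub>0" for a
      using tp[OF \<phi>, of a] that A\<^sub>0 by (auto simp: PiE_iff)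
    have "(\<forall>\<sigma> \<in> {inst \<phi> a | a. a \<in> {..<n} \<rightarrow>\<^sub>E A\<^sub>0 \<and> inst \<phi> a \<in> tp L U I b A} \<union>
        {Neg (inst \<phi> a) | a. a \<in> {..<n} \<rightarrow>\<^sub>E A\<^sub>0 \<and> Neg (inst \<phi> a) \<in> tp L U I b A}. holds_at U d \<sigma>) \<longleftrightarrow>
        (\<forall>a \<in> {..<n} \<rightarrow>\<^sub>E A\<^sub>0. (inst \<phi> a \<in> tp L U I b A \<longrightarrow> sat U (case_sum d a) \<phi>) \<and>
          (Neg (inst \<phi> a) \<in> tp L U I b A \<longrightarrow> \<not> sat U (case_sum d a) \<phi>))" for d
      unfolding holds_at_inst[symmetric] holds_at_Neg[symmetric] by blast
    also have "\<dots> d \<longleftrightarrow> (\<forall>a \<in> {..<n} \<rightarrow>\<^sub>E A\<^sub>0. sat U (case_sum d a) \<phi> \<longleftrightarrow> sat U (case_sum b a) \<phi>)" for d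
      using tp' by (intro ball_cong) auto
    finally show ?thesis unfolding implies_def holds_at_inst by simp
  qed
  show ?thesis
    unfolding compressible_def
    by (rule all_cong1, rule ball_cong[OF refl], rule ex_cong1, rule bex_cong[OF refl], rule all_cong1,
        rule imp_cong[OF refl], rule bex_cong[OF refl]) (simp add: tp(1) implies)
qed

text \<open>The tuples \<open>x\<close> parametrise the family of sets, and the shattered points are
  the \<open>vs j\<close> cut off to finitely many variables. The cut-off points stay distinct
  because shattering isolates singletons, so no point is lost in the count.\<close>

lemma (in definability) nip_dfn:
  assumes "NIP L U" "dfn R"
  shows "\<exists>d. \<forall>(N::nat) vs. (\<forall>j<N. range (vs j) \<subseteq> univ U) \<longrightarrow>
      (\<forall>S \<subseteq> {..<N}. \<exists>x \<in> tup (univ U) r. \<forall>j<N. R (pre x (vs j)) \<longleftrightarrow> j \<in> S) \<longrightarrow> N \<le> d"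
proof -
  obtain \<phi> :: "('f, 'r, nat) fm" where wf: "wf_fm L 0 \<phi>" and \<phi>: "\<And>e. range e \<subseteq> univ U \<Longrightarrow> R e = sat U e \<phi>"
    using assms(2) unfolding dfn_def by auto
  obtain K where K: "\<And>i. i \<in> fm_vars \<phi> \<Longrightarrow> i < K"
    using finite_fm_vars[of \<phi>] unfolding finite_nat_set_iff_bounded by blast
  \<comment> \<open>The first \<open>r\<close> variables become the parameter variables of the
    family, the later ones the object variables.\<close>
  define f :: "nat \<Rightarrow> nat + nat" where "f i = (if i < r then Inr i else Inl (i - r))" for i
  have "map_fm f \<phi> \<in> formulas L ({..<K} <+> {..<r})"
    using wf K by (auto simp: formulas_def wf_fm_map fm.set_map f_def image_subset_iff intro: less_imp_diff_less)
  from assms(1)[unfolded NIP_def, THEN spec, THEN spec, THEN bspec, OF this]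
  obtain d where d: "\<forall>S. finite S \<and> shatters {{d \<in> {..<K} \<rightarrow>\<^sub>E univ U. holds_at U d (inst (map_fm f \<phi>) b)} | b.
      b \<in> {..<r} \<rightarrow>\<^sub>E univ U} S \<longrightarrow> card S \<le> d"
    unfolding finite_VC_dim_def by (elim exE) (rule that)
  show ?thesis
  proof (intro exI[of _ d] allI impI)
    fix N :: nat and vs
    assume vs: "\<forall>j<N. range (vs j) \<subseteq> univ U"
      and shatter: "\<forall>S \<subseteq> {..<N}. \<exists>x \<in> tup (univ U) r. \<forall>j<N. R (pre x (vs j)) \<longleftrightarrow> j \<in> S"
    define D where "D j = restrict (vs j) {..<K}" for j
    have D: "D j \<in> {..<K} \<rightarrow>\<^sub>E univ U" if "j < N" for j
      using vs that by (auto simp: D_def)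
    have R_iff: "R (pre x (vs j)) \<longleftrightarrow> holds_at U (D j) (inst (map_fm f \<phi>) (restrict ((!) x) {..<r}))"
      if "x \<in> tup (univ U) r" "j < N" for x j
    proof -
      have "range (pre x (vs j)) \<subseteq> univ U"
        using that vs by (intro range_pre) (auto dest: tup_subset)
      moreover have "sat U (pre x (vs j)) \<phi> = sat U (case_sum (D j) (restrict ((!) x) {..<r}) \<circ> f) \<phi>"
        using tup_length[OF that(1)] K by (intro sat_cong) (auto simp: pre_apply f_def D_def dest!: K)
      ultimately show ?thesis by (simp add: \<phi> holds_at_inst sat_map)
    qed
    have inj: "inj_on D {..<N}"
    proof (rule inj_onI)
      fix i j assume ij: "i \<in> {..<N}" "j \<in> {..<N}" "D i = D j"
      obtain x where x: "x \<in> tup (univ U) r" "\<forall>j<N. R (pre x (vs j)) \<longleftrightarrow> j \<in> {i}"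
        using shatter[THEN spec, THEN mp, of "{i}"] ij by auto
      have "R (pre x (vs i)) = R (pre x (vs j))" using R_iff[OF x(1)] ij by simp
      then show "i = j" using x(2) ij by auto
    qed
    have "shatters {{d \<in> {..<K} \<rightarrow>\<^sub>E univ U. holds_at U d (inst (map_fm f \<phi>) b)} | b.
      b \<in> {..<r} \<rightarrow>\<^sub>E univ U} (D ` {..<N})"
      unfolding shatters_def
    proof (intro allI impI)
      fix S assume S: "S \<subseteq> D ` {..<N}"
      obtain x where x: "x \<in> tup (univ U) r" "\<forall>j<N. R (pre x (vs j)) \<longleftrightarrow> j \<in> {j \<in> {..<N}. D j \<in> S}"
        using shatter[THEN spec, THEN mp, of "{j \<in> {..<N}. D j \<in> S}"] by auto
      let ?b = "restrict ((!) x) {..<r}"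
      have "?b \<in> {..<r} \<rightarrow>\<^sub>E univ U" using x(1) by (auto simp: tup_def)
      moreover have "{d \<in> {..<K} \<rightarrow>\<^sub>E univ U. holds_at U d (inst (map_fm f \<phi>) ?b)} \<inter> D ` {..<N} = S"
      proof (rule set_eqI)
        fix e
        show "e \<in> {d \<in> {..<K} \<rightarrow>\<^sub>E univ U. holds_at U d (inst (map_fm f \<phi>) ?b)} \<inter> D ` {..<N} \<longleftrightarrow> e \<in> S"
        proof (cases "e \<in> D ` {..<N}")
          case True
          then obtain j where "j < N" "e = D j" by auto
          then show ?thesis using x(2) R_iff[OF x(1), of j] D[of j] by simp
        qed (use S in auto)
      qed
      ultimately show "\<exists>X\<in>{{d \<in> {..<K} \<rightarrow>\<^sub>E univ U. holds_at U d (inst (map_fm f \<phi>) b)} | b.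
          b \<in> {..<r} \<rightarrow>\<^sub>E univ U}. X \<inter> D ` {..<N} = S" by blast
    qed
    then have "card (D ` {..<N}) \<le> d" by (intro d[THEN spec, THEN mp] conjI) auto
    then show "N \<le> d" using card_image[OF inj] by simp
  qed
qed

section \<open>From arbitrary index sets to finite lists\<close>

lemma finite_enumeration:
  assumes "finite J"
  obtains js pos where "set js = J" "\<And>i. i \<in> J \<Longrightarrow> pos i < length js \<and> js ! pos i = i"
proof -
  obtain js where js: "set js = J" using finite_list[OF assms] by auto
  then have "\<forall>i. \<exists>k. i \<in> J \<longrightarrow> k < length js \<and> js ! k = i" by (metis in_set_conv_nth)
  then show thesis using that js by metis
qed

lemma (in definability) dfn2_sat:
  assumes "\<phi> \<in> formulas L (I <+> {..<n})" "\<And>i. Inl i \<in> fm_vars \<phi> \<Longrightarrow> pos i < l"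
  shows "dfn2 l n (\<lambda>x y. sat U (case_sum (\<lambda>i. x ! pos i) ((!) y)) \<phi>)"
  unfolding dfn2_def
proof (intro allI impI)
  fix X Y :: "(nat \<Rightarrow> 'a) \<Rightarrow> 'a list"
  assume "list_reindexing l X" "list_reindexing n Y"
  then obtain "is" js where X: "length is = l" "\<And>e. X e = map e is" and Y: "length js = n" "\<And>e. Y e = map e js"
    unfolding list_reindexing_def by auto
  let ?f = "case_sum (\<lambda>i. is ! pos i) ((!) js)"
  have "sat U (case_sum (\<lambda>i. X e ! pos i) ((!) (Y e))) \<phi> = sat U e (map_fm ?f \<phi>)" for e
    unfolding sat_map
  proof (rule sat_cong)
    fix v assume v: "v \<in> fm_vars \<phi>"
    then have "v \<in> I <+> {..<n}" using assms(1) by (auto simp: formulas_def)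
    then show "case_sum (\<lambda>i. X e ! pos i) ((!) (Y e)) v = (e \<circ> ?f) v"
      using X Y v assms(2) by (auto split: sum.splits)
  qed
  moreover have "wf_fm L 0 (map_fm ?f \<phi>)" using assms(1) by (simp add: formulas_def wf_fm_map)
  ultimately show "dfn (\<lambda>e. sat U (case_sum (\<lambda>i. X e ! pos i) ((!) (Y e))) \<phi>)"
    unfolding dfn_def by blast
qed

text \<open>A tuple prescribing the coordinates in \<open>J\<close> is completed by the values of
  \<open>b\<close>, so that compression of the full enumeration can be applied to it.\<close>

lemma extension_PiE:
  assumes "x \<in> tup M k" "\<And>i. i \<in> J \<Longrightarrow> pos i < k" "J \<subseteq> I" "b ` I \<subseteq> M"
  shows "(\<lambda>i. if i \<in> J then x ! pos i else if i \<in> I then b i else undefined) \<in> I \<rightarrow>\<^sub>E M"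
  using assms by (force simp: tup_def PiE_iff extensional_def)

lemma sat_lists:
  assumes "\<phi> \<in> formulas L (I <+> {..<n})"
    and "\<And>i. Inl i \<in> fm_vars \<phi> \<Longrightarrow> x ! pos i = d i" "\<And>j. j < n \<Longrightarrow> y ! j = a j"
  shows "sat U (case_sum (\<lambda>i. x ! pos i) ((!) y)) \<phi> = sat U (case_sum d a) \<phi>"
proof (rule sat_cong)
  fix v assume v: "v \<in> fm_vars \<phi>"
  then have "v \<in> I <+> {..<n}" using assms(1) by (auto simp: formulas_def)
  then show "case_sum (\<lambda>i. x ! pos i) ((!) y) v = case_sum d a v"
    using assms(2,3) v by (auto split: sum.splits)
qed

context definability begin

text \<open>Compressibility of the whole enumeration passes to a finite tuple of its entries by
  quantifying existentially over the remaining variables of the compressing formula.\<close>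

lemma compress_list:
  assumes comp: "compressible L U I A (tp L U I b A)" and b_U: "b ` I \<subseteq> univ U"
    and bs: "set bs \<subseteq> b ` I" and A: "A \<noteq> {}" and R: "dfn R" and A_U: "A \<subseteq> univ U"
  shows "\<exists>\<rho>. dfn \<rho> \<and> (\<forall>A\<^sub>0. finite A\<^sub>0 \<longrightarrow> A\<^sub>0 \<subseteq> A \<longrightarrow> (\<exists>w. range w \<subseteq> A \<and> \<rho> (pre bs w) \<and>
        (\<forall>z \<in> tup (univ U) (length bs). \<rho> (pre z w) \<longrightarrow>
          (\<forall>y. range y \<subseteq> A\<^sub>0 \<longrightarrow> (R (pre z y) \<longleftrightarrow> R (pre bs y))))))"
proof -
  define r where "r = length bs"
  obtain \<phi> :: "('f, 'r, nat) fm" where wf: "wf_fm L 0 \<phi>" and \<phi>: "\<And>e. range e \<subseteq> univ U \<Longrightarrow> R e = sat U e \<phi>"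
    using R unfolding dfn_def by auto
  obtain K where K: "\<And>i. i \<in> fm_vars \<phi> \<Longrightarrow> i < K"
    using finite_fm_vars[of \<phi>] unfolding finite_nat_set_iff_bounded by blast
  \<comment> \<open>The enumeration \<open>b\<close> need not be injective, so an index is chosen
    for each position of \<open>bs\<close>.\<close>
  have "\<forall>j. \<exists>i. j < r \<longrightarrow> i \<in> I \<and> b i = bs ! j"
    using bs nth_mem unfolding r_def by (metis imageE subsetD)
  then obtain ix where ix: "\<And>j. j < r \<Longrightarrow> ix j \<in> I \<and> b (ix j) = bs ! j" by metis
  define f where "f i = (if i < r then Inl (ix i) else Inr (i - r))" for i
  have \<phi>': "map_fm f \<phi> \<in> formulas L (I <+> {..<K})"
    using wf K ix by (auto simp: formulas_def wf_fm_map fm.set_map f_def image_subset_iff intro: less_imp_diff_less)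
  obtain m :: nat and \<psi> :: "('f, 'r, _) fm" where \<psi>: "\<psi> \<in> formulas L (I <+> {..<m})"
    and compress: "\<forall>A\<^sub>0. finite A\<^sub>0 \<and> A\<^sub>0 \<subseteq> A \<longrightarrow> (\<exists>c \<in> {..<m} \<rightarrow>\<^sub>E A. sat U (case_sum b c) \<psi> \<and>
       (\<forall>d \<in> I \<rightarrow>\<^sub>E univ U. sat U (case_sum d c) \<psi> \<longrightarrow>
         (\<forall>a \<in> {..<K} \<rightarrow>\<^sub>E A\<^sub>0. sat U (case_sum d a) (map_fm f \<phi>) \<longleftrightarrow> sat U (case_sum b a) (map_fm f \<phi>))))"
    using comp[unfolded compressible_tp_iff, THEN spec, THEN bspec, OF \<phi>'] by (elim exE bexE) (rule that)
  define J where "J = {i. Inl i \<in> fm_vars \<psi>} \<union> ix ` {..<r}"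
  have "finite {i. Inl i \<in> fm_vars \<psi>}"
    using finite_vimageI[OF finite_fm_vars[of \<psi>], of Inl] by (simp add: vimage_def)
  then have "finite J" by (simp add: J_def)
  then obtain js pos where js: "set js = J" and pos: "\<And>i. i \<in> J \<Longrightarrow> pos i < length js \<and> js ! pos i = i"
    by (rule finite_enumeration) (rule that)
  have J_I: "J \<subseteq> I" using \<psi> ix by (auto simp: J_def formulas_def)
  have ix_J: "ix i \<in> J" if "i < r" for i using that by (auto simp: J_def)
  define l where "l = length js"
  \<comment> \<open>Positions of \<open>bs\<close> may share an index; the equations then force
    equal entries of \<open>z\<close>.\<close>
  define \<rho> where "\<rho> = (\<lambda>e. \<exists>d \<in> tup (univ U) l. (\<forall>i<r. d ! pos (ix i) = e i) \<and>
      sat U (case_sum (\<lambda>i. d ! pos i) ((!) (map (\<lambda>i. e (i + r)) [0..<m]))) \<psi>)"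
  have "dfn (\<lambda>e. map e [0..<l] ! pos (ix i) = e (i + l))" if "i < r" for i
    using dfn_eq[of "pos (ix i)" "i + l"] pos[OF ix_J[OF that]] by (simp add: l_def)
  then have \<rho>: "dfn \<rho>"
    unfolding \<rho>_def
    by (intro dfn_ex dfn_conj dfn_all_less dfn2D[OF dfn2_sat[OF \<psi>]] reindexing_rules)
      (use pos in \<open>simp_all add: J_def l_def\<close>)
  have "\<exists>w. range w \<subseteq> A \<and> \<rho> (pre bs w) \<and> (\<forall>z \<in> tup (univ U) r. \<rho> (pre z w) \<longrightarrow>
      (\<forall>y. range y \<subseteq> A\<^sub>0 \<longrightarrow> (R (pre z y) \<longleftrightarrow> R (pre bs y))))" if A\<^sub>0: "finite A\<^sub>0" "A\<^sub>0 \<subseteq> A" for A\<^sub>0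
  proof -
    obtain a\<^sub>0 where a\<^sub>0: "a\<^sub>0 \<in> A" using A by auto
    obtain c where c: "c \<in> {..<m} \<rightarrow>\<^sub>E A" "sat U (case_sum b c) \<psi>"
      and c_decides: "\<forall>d \<in> I \<rightarrow>\<^sub>E univ U. sat U (case_sum d c) \<psi> \<longrightarrow>
         (\<forall>a \<in> {..<K} \<rightarrow>\<^sub>E A\<^sub>0. sat U (case_sum d a) (map_fm f \<phi>) \<longleftrightarrow> sat U (case_sum b a) (map_fm f \<phi>))"
      using compress[THEN spec, THEN mp, OF conjI[OF A\<^sub>0]] by (elim bexE conjE) (rule that)
    define w where "w i = (if i < m then c i else a\<^sub>0)" for i
    have w: "range w \<subseteq> A" using c(1) a\<^sub>0 by (auto simp: w_def)
    have \<rho>_pre: "\<rho> (pre z w) \<longleftrightarrow> (\<exists>d \<in> tup (univ U) l. (\<forall>i<r. d ! pos (ix i) = z ! i) \<and>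
        sat U (case_sum (\<lambda>i. d ! pos i) ((!) (map w [0..<m]))) \<psi>)" if "length z = r" for z
      using that by (simp add: \<rho>_def pre_shift pre_apply)
    have "map b js \<in> tup (univ U) l" using b_U js J_I by (auto simp: tup_def l_def)
    moreover have "\<forall>i<r. map b js ! pos (ix i) = bs ! i" using pos ix ix_J by simp
    moreover have "sat U (case_sum (\<lambda>i. map b js ! pos i) ((!) (map w [0..<m]))) \<psi>"
      using c(2) pos by (subst sat_lists[OF \<psi>, of _ _ b _ c]) (auto simp: J_def w_def)
    ultimately have "\<rho> (pre bs w)" by (subst \<rho>_pre) (auto simp: r_def)
    moreover have "R (pre z y) \<longleftrightarrow> R (pre bs y)"
      if z: "z \<in> tup (univ U) r" "\<rho> (pre z w)" and y: "range y \<subseteq> A\<^sub>0" for z y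
    proof -
      obtain d where d: "d \<in> tup (univ U) l" "\<forall>i<r. d ! pos (ix i) = z ! i"
          "sat U (case_sum (\<lambda>i. d ! pos i) ((!) (map w [0..<m]))) \<psi>"
        using z(2) \<rho>_pre[OF tup_length[OF z(1)]] by auto
      define d' where "d' i = (if i \<in> J then d ! pos i else if i \<in> I then b i else undefined)" for i
      have d'_I: "d' \<in> I \<rightarrow>\<^sub>E univ U"
        unfolding d'_def using pos by (intro extension_PiE[OF d(1) _ J_I b_U]) (simp add: l_def)
      have d'_sat: "sat U (case_sum d' c) \<psi>"
        using d(3) by (subst (asm) sat_lists[OF \<psi>, of _ _ d' _ c]) (auto simp: J_def d'_def w_def)
      have y_K: "restrict y {..<K} \<in> {..<K} \<rightarrow>\<^sub>E A\<^sub>0" using y by auto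
      have R_pre: "R (pre x y) = sat U (case_sum h (restrict y {..<K})) (map_fm f \<phi>)"
        if "x \<in> tup (univ U) r" "\<And>i. i < r \<Longrightarrow> h (ix i) = x ! i" for x h
      proof -
        have "range (pre x y) \<subseteq> univ U"
          using that(1) y A\<^sub>0(2) A_U by (intro range_pre) (auto dest: tup_subset)
        moreover have "sat U (pre x y) \<phi> = sat U (case_sum h (restrict y {..<K}) \<circ> f) \<phi>"
          using that(2) tup_length[OF that(1)] by (intro sat_cong) (auto simp: pre_apply f_def dest!: K)
        ultimately show ?thesis by (simp add: \<phi> sat_map)
      qed
      have "bs \<in> tup (univ U) r" using bs b_U by (auto simp: tup_def r_def)
      then have "R (pre bs y) = sat U (case_sum b (restrict y {..<K})) (map_fm f \<phi>)"
        using ix by (intro R_pre) auto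
      moreover have "R (pre z y) = sat U (case_sum d' (restrict y {..<K})) (map_fm f \<phi>)"
        using d(2) ix_J z(1) by (intro R_pre) (auto simp: d'_def)
      ultimately show ?thesis
        using c_decides[THEN bspec, OF d'_I, THEN mp, OF d'_sat, THEN bspec, OF y_K] by simp
    qed
    ultimately show ?thesis using w by blast
  qed
  then show ?thesis using \<rho> unfolding r_def by blast
qed

lemma dfn2_not: "dfn2 l n R \<Longrightarrow> dfn2 l n (\<lambda>x y. \<not> R x y)"
  unfolding dfn2_def by (auto intro: dfn_not)

end

section \<open>Transitivity\<close>

text \<open>Only the empty tuple has its entries in the empty set. For \<open>n = 0\<close> the
  formula or its negation, whichever holds at \<open>b\<close>, decides; otherwise there is nothing
  to decide and a true sentence suffices. The case stands apart because an empty set contains no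
  infinite parameter sequences.\<close>

lemma compressible_empty:
  fixes U :: "('f, 'r, 'a) fo_structure"
  shows "compressible L U I {} (tp L U I b {})"
  unfolding compressible_tp_iff
proof (intro allI ballI)
  fix n :: nat and \<phi> assume \<phi>: "\<phi> \<in> formulas L (I <+> {..<n})"
  let ?c = "\<lambda>_ :: nat. undefined :: 'a"
  define \<psi> where "\<psi> = (if n = 0 then (if sat U (case_sum b ?c) \<phi> then \<phi> else Neg \<phi>)
    else Neg (Ex (Neg (Eq (Bound 0) (Bound 0)))))"
  have \<psi>: "\<psi> \<in> formulas L (I <+> {..<0::nat})"
    using \<phi> by (auto simp: \<psi>_def formulas_def)
  have b_sat: "sat U (case_sum b ?c) \<psi>"
    by (simp add: \<psi>_def sat_def)
  have decides: "sat U (case_sum d a) \<phi> = sat U (case_sum b a) \<phi>"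
    if "sat U (case_sum d ?c) \<psi>" "a \<in> {..<n} \<rightarrow>\<^sub>E {}" for d a
  proof -
    have "n = 0" using that(2) by (auto simp: PiE_iff)
    then have "a = ?c" using that(2) by auto
    then show ?thesis using that(1) \<open>n = 0\<close> by (auto simp: \<psi>_def sat_def split: if_splits)
  qed
  show "\<exists>m::nat. \<exists>\<psi> \<in> formulas L (I <+> {..<m}).
     \<forall>A\<^sub>0. finite A\<^sub>0 \<and> A\<^sub>0 \<subseteq> {} \<longrightarrow> (\<exists>c \<in> {..<m} \<rightarrow>\<^sub>E {}. sat U (case_sum b c) \<psi> \<and>
       (\<forall>d \<in> I \<rightarrow>\<^sub>E univ U. sat U (case_sum d c) \<psi> \<longrightarrow>
         (\<forall>a \<in> {..<n} \<rightarrow>\<^sub>E A\<^sub>0. sat U (case_sum d a) \<phi> \<longleftrightarrow> sat U (case_sum b a) \<phi>)))"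
  proof (rule exI[of _ "0::nat"], rule bexI[OF _ \<psi>], rule allI, rule impI)
    fix A\<^sub>0 :: "'a set" assume "finite A\<^sub>0 \<and> A\<^sub>0 \<subseteq> {}"
    then have A\<^sub>0: "A\<^sub>0 = {}" by simp
    show "\<exists>c \<in> {..<0::nat} \<rightarrow>\<^sub>E {}. sat U (case_sum b c) \<psi> \<and>
       (\<forall>d \<in> I \<rightarrow>\<^sub>E univ U. sat U (case_sum d c) \<psi> \<longrightarrow>
         (\<forall>a \<in> {..<n} \<rightarrow>\<^sub>E A\<^sub>0. sat U (case_sum d a) \<phi> \<longleftrightarrow> sat U (case_sum b a) \<phi>))"
      unfolding A\<^sub>0
    proof (intro bexI[of _ ?c] conjI ballI impI)
      show "?c \<in> {..<0::nat} \<rightarrow>\<^sub>E {}" by simp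
    qed (rule b_sat, rule decides)
  qed
qed

section \<open>Compression of true and false instances together\<close>

context definability begin

text \<open>Only the finitely many variables of \<open>\<phi>\<close> and \<open>\<Psi>\<close>
  matter, so a finite subtuple \<open>c\<close> of \<open>b\<close> is treated. One-sided
  compression is applied to \<open>\<phi>\<close> and to its negation with the same
  \<open>\<Psi>\<close>, and the two resulting formulas are conjoined.\<close>

lemma compressible_trans:
  assumes NIP: "NIP L U" and A: "A \<noteq> {}" "A \<subseteq> b' ` I'"
    and b'_U: "b' ` I' \<subseteq> univ U" and b_U: "b ` I \<subseteq> univ U"
    and comp_b: "compressible L U I (b' ` I') (tp L U I b (b' ` I'))"
    and comp_b': "compressible L U I' A (tp L U I' b' A)"
  shows "compressible L U I A (tp L U I b A)"
  unfolding compressible_tp_iff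
proof (intro allI ballI)
  fix n :: nat and \<phi> assume \<phi>: "\<phi> \<in> formulas L (I <+> {..<n})"
  let ?B = "b' ` I'"
  obtain m :: nat and \<Psi> :: "('f, 'r, _) fm" where \<Psi>: "\<Psi> \<in> formulas L (I <+> {..<m})"
    and compress: "\<forall>B\<^sub>0. finite B\<^sub>0 \<and> B\<^sub>0 \<subseteq> ?B \<longrightarrow> (\<exists>c \<in> {..<m} \<rightarrow>\<^sub>E ?B. sat U (case_sum b c) \<Psi> \<and>
       (\<forall>d \<in> I \<rightarrow>\<^sub>E univ U. sat U (case_sum d c) \<Psi> \<longrightarrow>
         (\<forall>a \<in> {..<n} \<rightarrow>\<^sub>E B\<^sub>0. sat U (case_sum d a) \<phi> \<longleftrightarrow> sat U (case_sum b a) \<phi>)))"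
    using comp_b[unfolded compressible_tp_iff, THEN spec, THEN bspec, OF \<phi>] by (elim exE bexE) (rule that)
  define J where "J = {i. Inl i \<in> fm_vars \<phi>} \<union> {i. Inl i \<in> fm_vars \<Psi>}"
  have "finite J"
    using finite_vimageI[OF finite_fm_vars[of \<phi>], of Inl] finite_vimageI[OF finite_fm_vars[of \<Psi>], of Inl]
    by (simp add: vimage_def J_def)
  then obtain js pos where js: "set js = J" and pos: "\<And>i. i \<in> J \<Longrightarrow> pos i < length js \<and> js ! pos i = i"
    by (rule finite_enumeration) (rule that)
  have J_I: "J \<subseteq> I" using \<phi> \<Psi> by (auto simp: J_def formulas_def)
  define l where "l = length js"
  define c where "c = map b js"
  define F where "F x y = sat U (case_sum (\<lambda>i. x ! pos i) ((!) y)) \<phi>" for x y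
  define G where "G x y = sat U (case_sum (\<lambda>i. x ! pos i) ((!) y)) \<Psi>" for x y
  have F: "dfn2 l n F" and G: "dfn2 l m G"
    unfolding F_def G_def using pos by (intro dfn2_sat[OF \<phi>] dfn2_sat[OF \<Psi>]; simp add: J_def l_def)+
  have c: "c \<in> tup (univ U) l" using b_U js J_I by (auto simp: tup_def l_def c_def)
  have c_pos: "c ! pos i = b i" if "i \<in> J" for i using pos[OF that] by (simp add: c_def)
  have decide: "\<exists>z \<in> tup ?B m. G c z \<and> (\<forall>x \<in> tup (univ U) l. G x z \<longrightarrow> (\<forall>y \<in> tup A\<^sub>0 n. F x y \<longleftrightarrow> F c y))"
    if A\<^sub>0: "finite A\<^sub>0" "A\<^sub>0 \<subseteq> A" for A\<^sub>0
  proof -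
    have A\<^sub>0_B: "finite A\<^sub>0 \<and> A\<^sub>0 \<subseteq> ?B" using A\<^sub>0 A by auto
    obtain z where z: "z \<in> {..<m} \<rightarrow>\<^sub>E ?B" "sat U (case_sum b z) \<Psi>"
      and decides: "\<forall>d \<in> I \<rightarrow>\<^sub>E univ U. sat U (case_sum d z) \<Psi> \<longrightarrow>
         (\<forall>a \<in> {..<n} \<rightarrow>\<^sub>E A\<^sub>0. sat U (case_sum d a) \<phi> \<longleftrightarrow> sat U (case_sum b a) \<phi>)"
      using compress[THEN spec, THEN mp, OF A\<^sub>0_B] by (elim bexE conjE) (rule that)
    have "map z [0..<m] \<in> tup ?B m" using z(1) by (auto simp: tup_def)
    moreover have "G c (map z [0..<m])"
      using z(2) c_pos unfolding G_def by (subst sat_lists[OF \<Psi>, of _ _ b _ z]) (auto simp: J_def)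
    moreover have "F x y \<longleftrightarrow> F c y" if x: "x \<in> tup (univ U) l" "G x (map z [0..<m])" and y: "y \<in> tup A\<^sub>0 n" for x y
    proof -
      define d where "d i = (if i \<in> J then x ! pos i else if i \<in> I then b i else undefined)" for i
      have d: "d \<in> I \<rightarrow>\<^sub>E univ U"
        unfolding d_def using pos by (intro extension_PiE[OF x(1) _ J_I b_U]) (simp add: l_def)
      have d_sat: "sat U (case_sum d z) \<Psi>"
        using x(2) unfolding G_def by (subst (asm) sat_lists[OF \<Psi>, of _ _ d _ z]) (auto simp: J_def d_def)
      have y': "restrict ((!) y) {..<n} \<in> {..<n} \<rightarrow>\<^sub>E A\<^sub>0" using y by (auto simp: tup_def)
      have "F x y = sat U (case_sum d (restrict ((!) y) {..<n})) \<phi>"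
        unfolding F_def by (rule sat_lists[OF \<phi>]) (auto simp: J_def d_def)
      moreover have "F c y = sat U (case_sum b (restrict ((!) y) {..<n})) \<phi>"
        unfolding F_def using c_pos by (intro sat_lists[OF \<phi>]) (auto simp: J_def)
      ultimately show ?thesis
        using decides[THEN bspec, OF d, THEN mp, OF d_sat, THEN bspec, OF y'] by simp
    qed
    ultimately show ?thesis by blast
  qed
  have B_A: "A \<subseteq> univ U" using A b'_U by auto
  note compress_B = compress_list[OF comp_b' b'_U _ A(1) _ B_A]
  have decide_pos: "\<exists>z \<in> tup ?B m. G c z \<and> (\<forall>x \<in> tup (univ U) l. G x z \<longrightarrow>
      (\<forall>y \<in> tup A\<^sub>0 n. \<not> F c y \<longrightarrow> \<not> F x y))" if "finite A\<^sub>0" "A\<^sub>0 \<subseteq> A" for A\<^sub>0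
    using decide[OF that] by (elim bexE) (intro bexI; auto)
  have decide_neg: "\<exists>z \<in> tup ?B m. G c z \<and> (\<forall>x \<in> tup (univ U) l. G x z \<longrightarrow>
      (\<forall>y \<in> tup A\<^sub>0 n. \<not> \<not> F c y \<longrightarrow> \<not> \<not> F x y))" if "finite A\<^sub>0" "A\<^sub>0 \<subseteq> A" for A\<^sub>0
    using decide[OF that] by (elim bexE) (intro bexI; auto)
  interpret pos: compression L U A ?B l n m c F G
    by (rule compression.intro) (erule nip_dfn[OF NIP], fact, fact, fact, fact, fact, fact,
      erule (1) decide_pos, erule (1) compress_B)
  interpret neg: compression L U A ?B l n m c "\<lambda>x y. \<not> F x y" G
    by (rule compression.intro) (erule nip_dfn[OF NIP], fact, fact, fact, fact, rule dfn2_not[OF F], fact,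
      erule (1) decide_neg, erule (1) compress_B)
  obtain \<psi>\<^sub>1 where \<psi>\<^sub>1: "dfn \<psi>\<^sub>1" and compress\<^sub>1: "\<forall>A\<^sub>0. finite A\<^sub>0 \<longrightarrow> A\<^sub>0 \<subseteq> A \<longrightarrow> (\<exists>a. range a \<subseteq> A \<and> \<psi>\<^sub>1 (pre c a) \<and>
     (\<forall>x \<in> tup (univ U) l. \<psi>\<^sub>1 (pre x a) \<longrightarrow> (\<forall>y \<in> tup A\<^sub>0 n. \<not> F c y \<longrightarrow> \<not> F x y)))"
    using pos.one_sided_compression by (elim exE conjE) (rule that)
  obtain \<psi>\<^sub>2 where \<psi>\<^sub>2: "dfn \<psi>\<^sub>2" and compress\<^sub>2: "\<forall>A\<^sub>0. finite A\<^sub>0 \<longrightarrow> A\<^sub>0 \<subseteq> A \<longrightarrow> (\<exists>a. range a \<subseteq> A \<and> \<psi>\<^sub>2 (pre c a) \<and>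
     (\<forall>x \<in> tup (univ U) l. \<psi>\<^sub>2 (pre x a) \<longrightarrow> (\<forall>y \<in> tup A\<^sub>0 n. \<not> \<not> F c y \<longrightarrow> \<not> \<not> F x y)))"
    using neg.one_sided_compression by (elim exE conjE) (rule that)
  \<comment> \<open>Each of the two formulas reads its parameters from a row of its own, so their
    parameter sequences can be chosen independently.\<close>
  define \<psi> where "\<psi> = (\<lambda>e. \<psi>\<^sub>1 (pre (map e [0..<l]) (row 0 (\<lambda>i. e (i + l)))) \<and>
      \<psi>\<^sub>2 (pre (map e [0..<l]) (row 1 (\<lambda>i. e (i + l)))))"
  have "dfn \<psi>"
    unfolding \<psi>_def by (intro dfn_conj dfn_reindexing[OF \<psi>\<^sub>1] dfn_reindexing[OF \<psi>\<^sub>2] reindexing_rules) simp_all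
  then obtain \<chi> :: "('f, 'r, nat) fm" where wf: "wf_fm L 0 \<chi>"
    and \<chi>: "\<And>e. range e \<subseteq> univ U \<Longrightarrow> \<psi> e = sat U e \<chi>"
    unfolding dfn_def by auto
  obtain K where K: "\<And>i. i \<in> fm_vars \<chi> \<Longrightarrow> i < K"
    using finite_fm_vars[of \<chi>] unfolding finite_nat_set_iff_bounded by blast
  define f where "f i = (if i < l then Inl (js ! i) else Inr (i - l))" for i
  have f: "map_fm f \<chi> \<in> formulas L (I <+> {..<K})"
    using wf K J_I js nth_mem[of _ js]
    by (auto simp: formulas_def wf_fm_map fm.set_map f_def l_def image_subset_iff intro: less_imp_diff_less)
  have "\<exists>a \<in> {..<K} \<rightarrow>\<^sub>E A. sat U (case_sum b a) (map_fm f \<chi>) \<and>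
       (\<forall>d \<in> I \<rightarrow>\<^sub>E univ U. sat U (case_sum d a) (map_fm f \<chi>) \<longrightarrow>
         (\<forall>y \<in> {..<n} \<rightarrow>\<^sub>E A\<^sub>0. sat U (case_sum d y) \<phi> \<longleftrightarrow> sat U (case_sum b y) \<phi>))"
    if A\<^sub>0: "finite A\<^sub>0" "A\<^sub>0 \<subseteq> A" for A\<^sub>0
  proof -
    obtain a\<^sub>1 where a\<^sub>1: "range a\<^sub>1 \<subseteq> A" "\<psi>\<^sub>1 (pre c a\<^sub>1)"
      "\<forall>x \<in> tup (univ U) l. \<psi>\<^sub>1 (pre x a\<^sub>1) \<longrightarrow> (\<forall>y \<in> tup A\<^sub>0 n. \<not> F c y \<longrightarrow> \<not> F x y)"
      using compress\<^sub>1[THEN spec, THEN mp, THEN mp, OF A\<^sub>0] by (elim exE conjE) (rule that)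
    obtain a\<^sub>2 where a\<^sub>2: "range a\<^sub>2 \<subseteq> A" "\<psi>\<^sub>2 (pre c a\<^sub>2)"
      "\<forall>x \<in> tup (univ U) l. \<psi>\<^sub>2 (pre x a\<^sub>2) \<longrightarrow> (\<forall>y \<in> tup A\<^sub>0 n. \<not> \<not> F c y \<longrightarrow> \<not> \<not> F x y)"
      using compress\<^sub>2[THEN spec, THEN mp, THEN mp, OF A\<^sub>0] by (elim exE conjE) (rule that)
    define a where "a = mix (case_nat a\<^sub>1 (\<lambda>_. a\<^sub>2))"
    have a: "range a \<subseteq> A" unfolding a_def using a\<^sub>1 a\<^sub>2 by (intro range_mix) (auto split: nat.splits)
    have \<psi>_iff: "\<psi> (pre x a) \<longleftrightarrow> \<psi>\<^sub>1 (pre x a\<^sub>1) \<and> \<psi>\<^sub>2 (pre x a\<^sub>2)" if "x \<in> tup (univ U) l" for x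
      using that by (simp add: \<psi>_def a_def map_pre tup_length pre_shift)
    have sat_iff: "sat U (case_sum d (restrict a {..<K})) (map_fm f \<chi>) \<longleftrightarrow> \<psi> (pre (map d js) a)"
      if d: "map d js \<in> tup (univ U) l" for d
    proof -
      have "range (pre (map d js) a) \<subseteq> univ U"
        using tup_subset[OF d] a B_A by (intro range_pre) auto
      moreover have "sat U (pre (map d js) a) \<chi> = sat U (case_sum d (restrict a {..<K}) \<circ> f) \<chi>"
        by (intro sat_cong) (auto simp: pre_apply f_def l_def dest!: K)
      ultimately show ?thesis by (simp add: \<chi> sat_map)
    qed
    have "restrict a {..<K} \<in> {..<K} \<rightarrow>\<^sub>E A" using a by auto
    moreover have "sat U (case_sum b (restrict a {..<K})) (map_fm f \<chi>)"
      using sat_iff[of b] \<psi>_iff[OF c] a\<^sub>1(2) a\<^sub>2(2) c by (simp add: c_def)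
    moreover have "sat U (case_sum d y) \<phi> \<longleftrightarrow> sat U (case_sum b y) \<phi>"
      if d: "d \<in> I \<rightarrow>\<^sub>E univ U" "sat U (case_sum d (restrict a {..<K})) (map_fm f \<chi>)"
        and y: "y \<in> {..<n} \<rightarrow>\<^sub>E A\<^sub>0" for d y
    proof -
      let ?y = "map y [0..<n]"
      have x: "map d js \<in> tup (univ U) l" using d(1) js J_I by (auto simp: tup_def l_def)
      have y': "?y \<in> tup A\<^sub>0 n" using PiE_mem[OF y] by (intro tupI) auto
      have "\<psi>\<^sub>1 (pre (map d js) a\<^sub>1)" "\<psi>\<^sub>2 (pre (map d js) a\<^sub>2)"
        using d(2) sat_iff[OF x] \<psi>_iff[OF x] by auto
      then have "F (map d js) ?y \<longleftrightarrow> F c ?y"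
        using a\<^sub>1(3) a\<^sub>2(3) x y' by blast
      moreover have "F (map d js) ?y = sat U (case_sum d y) \<phi>"
        unfolding F_def using pos by (intro sat_lists[OF \<phi>]) (auto simp: J_def)
      moreover have "F c ?y = sat U (case_sum b y) \<phi>"
        unfolding F_def using c_pos by (intro sat_lists[OF \<phi>]) (auto simp: J_def)
      ultimately show ?thesis by simp
    qed
    ultimately show ?thesis by blast
  qed
  then show "\<exists>m::nat. \<exists>\<psi> \<in> formulas L (I <+> {..<m}). \<forall>A\<^sub>0. finite A\<^sub>0 \<and> A\<^sub>0 \<subseteq> A \<longrightarrow>
      (\<exists>c \<in> {..<m} \<rightarrow>\<^sub>E A. sat U (case_sum b c) \<psi> \<and> (\<forall>d \<in> I \<rightarrow>\<^sub>E univ U. sat U (case_sum d c) \<psi> \<longrightarrow>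
         (\<forall>a \<in> {..<n} \<rightarrow>\<^sub>E A\<^sub>0. sat U (case_sum d a) \<phi> \<longleftrightarrow> sat U (case_sum b a) \<phi>)))"
    by (intro exI[of _ K] bexI[OF _ f] allI impI) (elim conjE)
qed

end

theorem proposition6p25:
  fixes L :: "('f, 'r) fo_language"
    and T :: "('f, 'r, nat) fm set"
    and U :: "('f, 'r, 'a) fo_structure"
    and A B C :: "'a set"
  assumes "complete_theory L T"
    and "monster_model L T U"
    and "NIP L U"
    and "small U A" and "small U B" and "small U C"
    and "A \<subseteq> B" and "B \<subseteq> C"
    and "compressible_over L U C B"
    and "compressible_over L U B A"
  shows "compressible_over L U C A"
proof -
  obtain I :: "'a set" and b where b: "b ` I = C" "compressible L U I B (tp L U I b B)"
    using assms(9) unfolding compressible_over_def by blast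
  obtain I' :: "'a set" and b' where b': "b' ` I' = B" "compressible L U I' A (tp L U I' b' A)"
    using assms(10) unfolding compressible_over_def by blast
  have "compressible L U I A (tp L U I b A)"
  proof (cases "A = {}")
    case True
    then show ?thesis by (simp add: compressible_empty)
  next
    case False
    have "B \<subseteq> univ U" "C \<subseteq> univ U" using assms(5,6) by (simp_all add: small_def)
    then show ?thesis
      using definability.compressible_trans[OF assms(3) False, of b' I' b I] assms(7) b b' by simp
  qed
  then show ?thesis using b(1) unfolding compressible_over_def by blast
qed

end
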